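(* Let $p,q>1$, $A>0$, $B>0$, $R\ge 1$, and let $f\in C_0^2(\mathbf{R})$, $g\in C_0^1(\mathbf{R})$ be real-valued functions with $\operatorname{supp} f,\ \operatorname{supp} g\subset\{x\in\mathbf{R}:|x|\le R\}$. Assume $$\int_{\mathbf{R}}g(x)\,dx\neq 0.$$ Then there exist a positive constant $\varepsilon_1=\varepsilon_1(f,g,p,q,A,B,R)>0$ and a positive constant $c$ independent of $\varepsilon$ such that, for every $\varepsilon$ with $0<\varepsilon\le\varepsilon_1$, a classical solution $u\in C^2(\mathbf{R}\times[0,T])$ of the initial value problem $$u_{tt}-u_{xx}=A|u_t|^p+B|u|^q,\qquad u(x,0)=\varepsilon f(x),\quad u_t(x,0)=\varepsilon g(x)\quad(x\in\mathbf{R})$$ exists on $\mathbf{R}\times[0,T]$ as long as $T>0$ satisfies $$T\le\begin{cases} c\,\varepsilon^{-(p-1)} & \text{for } p\le \dfrac{q+1}{2},\\[2mm] c\,\varepsilon^{-(q-1)/2} & \text{for } \dfrac{q+1}{2}\le p.\end{cases}$$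
   Context: Here $C_0^k(\mathbf{R})$ denotes the space of $k$ times continuously differentiable functions on $\mathbf{R}$ with compact support. A classical solution on $\mathbf{R}\times[0,T]$ is a real-valued function $u=u(x,t)$ of class $C^2$ on $\mathbf{R}\times[0,T]$ satisfying the equation there and the initial conditions at $t=0$. *)

theory Defs
  imports "HOL-Analysis.Analysis"
begin

definition supp :: "(real \<Rightarrow> real) \<Rightarrow> real set" where
  "supp f = closure {x. f x \<noteq> 0}"

primrec C_k :: "nat \<Rightarrow> (real \<Rightarrow> real) \<Rightarrow> bool" where
  "C_k 0 f \<longleftrightarrow> continuous_on UNIV f"
| "C_k (Suc k) f \<longleftrightarrow> (\<forall>x. f differentiable (at x)) \<and> C_k k (deriv f)"

definition C0_k :: "nat \<Rightarrow> (real \<Rightarrow> real) set" where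
  "C0_k k = {f. C_k k f \<and> compact (supp f)}"

definition strip :: "real \<Rightarrow> (real \<times> real) set" where
  "strip T = UNIV \<times> {0..T}"

definition D_x :: "(real \<Rightarrow> real \<Rightarrow> real) \<Rightarrow> real \<Rightarrow> real \<Rightarrow> real" where
  "D_x u x t = deriv (\<lambda>y. u y t) x"

text \<open>The time derivative is taken within the interval from 0 to T, so it is one-sided at
  the two endpoints and ignores the values of u outside the strip. It is only meaningful
  for T > 0 and t in the interval.\<close>

definition D_t :: "real \<Rightarrow> (real \<Rightarrow> real \<Rightarrow> real) \<Rightarrow> real \<Rightarrow> real \<Rightarrow> real" where
  "D_t T u x t = vector_derivative (\<lambda>s. u x s) (at t within {0..T})"

text \<open>Class C^k on the closed strip: all partial derivatives up to order k, mixed ones in every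
  order of differentiation included, exist and are (jointly) continuous on the strip up to its
  boundary.\<close>

primrec C_k_strip :: "nat \<Rightarrow> real \<Rightarrow> (real \<Rightarrow> real \<Rightarrow> real) \<Rightarrow> bool" where
  "C_k_strip 0 T u \<longleftrightarrow> continuous_on (strip T) (\<lambda>(x, t). u x t)"
| "C_k_strip (Suc k) T u \<longleftrightarrow>
     continuous_on (strip T) (\<lambda>(x, t). u x t) \<and>
     (\<forall>x. \<forall>t\<in>{0..T}. (\<lambda>y. u y t) differentiable (at x) \<and>
                   (\<lambda>s. u x s) differentiable (at t within {0..T})) \<and>
     C_k_strip k T (D_x u) \<and> C_k_strip k T (D_t T u)"

definition classical_solution ::
  "real \<Rightarrow> real \<Rightarrow> real \<Rightarrow> real \<Rightarrow> (real \<Rightarrow> real) \<Rightarrow> (real \<Rightarrow> real) \<Rightarrow> real \<Rightarrow>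
   (real \<Rightarrow> real \<Rightarrow> real) \<Rightarrow> bool" where
  "classical_solution p q A B u0 u1 T u \<longleftrightarrow>
     C_k_strip 2 T u \<and>
     (\<forall>x. \<forall>t\<in>{0..T}. D_t T (D_t T u) x t - D_x (D_x u) x t
                    = A * \<bar>D_t T u x t\<bar> powr p + B * \<bar>u x t\<bar> powr q) \<and>
     (\<forall>x. u x 0 = u0 x) \<and> (\<forall>x. D_t T u x 0 = u1 x)"

end

theory Submission
  imports Defs
begin

text \<open>Take \<open>w = u\<^sub>t\<close> as the only unknown. Integration along the characteristics gives
  \<open>w = w\<^sub>0 + (P + Q) / 2\<close>, where \<open>P\<close> and \<open>Q\<close> are the integrals of
  \<open>A \<bar>w\<bar>\<^sup>p + B \<bar>u\<bar>\<^sup>q\<close> along the two characteristics through a point and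
  \<open>u(x, t) = \<epsilon> f(x) + \<integral> w(x, s) ds\<close> over \<open>0 \<le> s \<le> t\<close>. The free part \<open>w\<^sub>0\<close> lives within
  distance \<open>R\<close> of the light cone, where \<open>w\<close> has size \<open>\<epsilon>\<close>. A characteristic ending inside the
  cone meets that region in a bounded length, so there \<open>w\<close> has size \<open>\<epsilon> / (1 + T)\<close>, and a
  vertical line meets it in a bounded length too, so \<open>u\<close> has size \<open>\<epsilon>\<close>. These bounds
  reproduce themselves as long as \<open>\<epsilon>\<^bsup>p-1\<^esup> (1 + T)\<close> and
  \<open>\<epsilon>\<^bsup>q-1\<^esup> (1 + T)\<^sup>2\<close> are small, which is what the two cases of the lifespan say. The fixed
  point itself is found with a weight exponential in time.\<close>

subsection \<open>Integration along characteristics\<close>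

text \<open>The nonlinearity is only C^1 where an exponent is below 2, so a Picard iteration in a
  C^1 norm need not contract. The fixed point is therefore sought among continuous functions, and
  the space derivative of \<open>w\<close> is recovered afterwards from the linearised equation. One
  derivative suffices: \<open>u_t\<close> and \<open>u_x\<close> are the half sum and half
  difference of two Riemann invariants, so second derivatives of \<open>u\<close> are first
  derivatives of these. Smallness of \<epsilon> serves only to keep the set of admissible
  \<open>w\<close> invariant; the contraction comes from the exponential weight, whatever the
  Lipschitz constant. The choice of \<open>w\<close> is decisive: the data enter it only through
  \<open>g\<close> and \<open>f'\<close> at \<open>x + t\<close> and \<open>x - t\<close>, hence
  vanish deep inside the cone, whereas \<open>u\<close> may keep size \<epsilon> there. So the
  \<open>q\<close>-term contributes up to \<epsilon>^q (1 + T) along a characteristic, while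
  \<open>w\<close> may only have size \<epsilon> / (1 + T): this is where the square of 1 + T, and
  with it the exponent (q - 1) / 2, comes from.\<close>

text \<open>Slopes \<open>\<sigma> = 1\<close> and \<open>\<sigma> = - 1\<close> are the characteristics; \<open>\<sigma> = 0\<close> integrates in
  time only and recovers \<open>u\<close> from its time derivative.\<close>

definition ray :: "real \<Rightarrow> (real \<Rightarrow> real \<Rightarrow> real) \<Rightarrow> real \<Rightarrow> real \<Rightarrow> real" where
  "ray \<sigma> F x t = integral {0..t} (\<lambda>s. F (x + \<sigma> * (t - s)) s)"

text \<open>This is the time derivative of Duhamel's integral, half the integral of \<open>F\<close>
  over the backward triangle with vertex \<open>(x, t)\<close>.\<close>

definition wave :: "(real \<Rightarrow> real \<Rightarrow> real) \<Rightarrow> real \<Rightarrow> real \<Rightarrow> real" where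
  "wave F x t = (ray 1 F x t + ray (- 1) F x t) / 2"

lemma abs_wave_le: "\<bar>ray 1 F x t\<bar> \<le> c \<Longrightarrow> \<bar>ray (- 1) F x t\<bar> \<le> c \<Longrightarrow> \<bar>wave F x t\<bar> \<le> c"
  by (simp add: wave_def abs_le_iff)

lemma continuous_on_strip_compose:
  assumes "continuous_on (strip T) (\<lambda>(x, t). F x t)"
    and "continuous_on D a" "continuous_on D b" "\<And>z. z \<in> D \<Longrightarrow> b z \<in> {0..T}"
  shows "continuous_on D (\<lambda>z. F (a z) (b z))"
proof -
  have "continuous_on D (\<lambda>z. (\<lambda>(x, t). F x t) (a z, b z))"
    by (rule continuous_on_compose2[OF assms(1)]) (use assms in \<open>auto simp: strip_def intro!: continuous_intros\<close>)
  then show ?thesis by simp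
qed

lemma continuous_on_ray_integrand:
  assumes "continuous_on (strip T) (\<lambda>(x, t). F x t)" "t \<le> T"
  shows "continuous_on {0..t} (\<lambda>s. F (x + \<sigma> * (t - s)) s)"
  by (rule continuous_on_strip_compose[OF assms(1)]) (use assms(2) in \<open>auto intro!: continuous_intros\<close>)

text \<open>Moves the variable endpoint of a ray integral into the integrand, so that joint
  continuity in \<open>(x, t)\<close> reduces to continuity of a parameter integral over the fixed
  interval from 0 to 1.\<close>

lemma integral_rescale_unit:
  fixes h :: "real \<Rightarrow> real"
  assumes "continuous_on {0..t} h" "0 \<le> t"
  shows "integral {0..t} h = t * integral {0..1} (\<lambda>r. h (t * r))"
proof (cases "t = 0")
  case False
  then have "t > 0" using assms by simp
  have "((\<lambda>x. t *\<^sub>R h (t * x)) has_integral (integral {t * 0..t * 1} h)) {0..1}"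
    by (rule has_integral_substitution[where c = 0 and d = t])
       (use assms \<open>t > 0\<close> in \<open>auto intro!: derivative_eq_intros simp: mult_left_le\<close>)
  from integral_unique[OF this] show ?thesis by simp
qed simp

lemma continuous_on_ray:
  assumes F: "continuous_on (strip T) (\<lambda>(x, t). F x t)"
  shows "continuous_on (strip T) (\<lambda>(x, t). ray \<sigma> F x t)"
proof -
  have cI: "continuous_on ((UNIV \<times> {0..T}) \<times> cbox 0 1)
      (\<lambda>((x, t), r). F (x + \<sigma> * (t - t * r)) (t * r))"
    unfolding split_beta
    by (rule continuous_on_strip_compose[OF F]) (auto intro!: continuous_intros mult_nonneg_nonneg order_trans[OF mult_left_le])
  have "continuous_on (UNIV \<times> {0..T})
      (\<lambda>z. snd z * integral (cbox 0 1) (\<lambda>r. F (fst z + \<sigma> * (snd z - snd z * r)) (snd z * r)))"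
    by (rule continuous_on_mult[OF continuous_on_snd[OF continuous_on_id]
          integral_continuous_on_param]) (use cI in \<open>simp add: split_beta\<close>)
  then show ?thesis unfolding strip_def
    by (rule continuous_on_eq)
       (auto simp: ray_def integral_rescale_unit[OF continuous_on_ray_integrand[OF F]])
qed

lemma continuous_on_wave:
  assumes F: "continuous_on (strip T) (\<lambda>(x, t). F x t)"
  shows "continuous_on (strip T) (\<lambda>(x, t). wave F x t)"
  using continuous_on_ray[OF F, of 1] continuous_on_ray[OF F, of "-1"]
  unfolding wave_def split_beta by (intro continuous_intros) auto

lemma ray_integrable:
  fixes F :: "real \<Rightarrow> real \<Rightarrow> real"
  assumes "continuous_on (strip T) (\<lambda>(x, t). F x t)" "t \<le> T"
  shows "(\<lambda>s. F (x + \<sigma> * (t - s)) s) integrable_on {0..t}"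
  by (rule integrable_continuous_real[OF continuous_on_ray_integrand[OF assms]])

lemma ray_linear:
  assumes "continuous_on (strip T) (\<lambda>(x, t). F x t)" "continuous_on (strip T) (\<lambda>(x, t). G x t)" "t \<le> T"
  shows "ray \<sigma> (\<lambda>x t. a * F x t + b * G x t) x t = a * ray \<sigma> F x t + b * ray \<sigma> G x t"
  unfolding ray_def
  using ray_integrable[OF assms(1,3), of x \<sigma>] ray_integrable[OF assms(2,3), of x \<sigma>]
  by (subst integral_add) (auto intro: integrable_on_mult_right)

section \<open>Pointwise bounds for ray integrals\<close>

lemma abs_ray_le:
  assumes "continuous_on (strip T) (\<lambda>(x, t). F x t)" "t \<le> T"
    and "\<And>s. s \<in> {0..t} \<Longrightarrow> \<bar>F (x + \<sigma> * (t - s)) s\<bar> \<le> h s" "(h has_integral I) {0..t}"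
  shows "\<bar>ray \<sigma> F x t\<bar> \<le> I"
  unfolding ray_def using assms(3,4)
  by (metis (mono_tags, lifting) assms(1,2) integral_norm_bound_integral integral_unique
      has_integral_integrable ray_integrable real_norm_def)

text \<open>Integrating the weight gains a factor \<open>1 / l\<close> that does not depend on
  \<open>T\<close>. This gain replaces smallness in the contraction and in the Gronwall
  estimate.\<close>

lemma abs_ray_le_exp:
  assumes "continuous_on (strip T) (\<lambda>(x, t). F x t)" "0 \<le> t" "t \<le> T" "l > 0" "C \<ge> 0"
    and "\<And>y s. s \<in> {0..t} \<Longrightarrow> \<bar>F y s\<bar> \<le> C * exp (l * s)"
  shows "\<bar>ray \<sigma> F x t\<bar> \<le> C / l * exp (l * t)"
proof -
  have "((\<lambda>s. C * exp (l * s)) has_integral C / l * exp (l * t) - C / l * exp (l * 0)) {0..t}"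
    by (rule fundamental_theorem_of_calculus)
       (use assms in \<open>auto intro!: derivative_eq_intros simp: has_real_derivative_iff_has_vector_derivative[symmetric]\<close>)
  from abs_ray_le[OF assms(1,3,6) this] have "\<bar>ray \<sigma> F x t\<bar> \<le> C / l * exp (l * t) - C / l"
    by simp
  moreover have "C / l \<ge> 0" using assms by simp
  ultimately show ?thesis by linarith
qed

lemma abs_ray_le_const:
  assumes "continuous_on (strip T) (\<lambda>(x, t). F x t)" "0 \<le> t" "t \<le> T"
    and "\<And>s. s \<in> {0..t} \<Longrightarrow> \<bar>F (x + \<sigma> * (t - s)) s\<bar> \<le> C"
  shows "\<bar>ray \<sigma> F x t\<bar> \<le> t * C"
  using abs_ray_le[OF assms(1,3,4) has_integral_const_real] assms(2) by simp

text \<open>Meant for a ray crossing the neighbourhood of the light cone: \<open>K\<close> is the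
  large bound, valid during the crossing, and \<open>k\<close> the small one valid at other times.
  The crossing contributes its duration \<open>b - a\<close>, independent of
  \<open>t\<close>.\<close>

lemma abs_ray_le_bump:
  assumes "continuous_on (strip T) (\<lambda>(x, t). F x t)" "0 \<le> t" "t \<le> T" "K \<ge> 0" "a \<le> b"
    and "\<And>s. s \<in> {0..t} \<Longrightarrow> \<bar>F (x + \<sigma> * (t - s)) s\<bar> \<le> k + (if s \<in> {a..b} then K else 0)"
  shows "\<bar>ray \<sigma> F x t\<bar> \<le> t * k + (b - a) * K"
proof -
  \<comment> \<open>The window from \<open>a\<close> to \<open>b\<close> may stick out of the
    integration interval or miss it altogether; in both cases the part inside contributes at most
    \<open>(b - a) * K\<close>.\<close>
  have "((\<lambda>s. K) has_integral (min b t - max a 0) * K) {max a 0..min b t}" if "max a 0 \<le> min b t"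
    using has_integral_const_real[of K "max a 0" "min b t"] that by simp
  moreover have "((\<lambda>s. K) has_integral 0) {max a 0..min b t}" if "\<not> max a 0 \<le> min b t"
    using that by simp
  ultimately obtain I where I: "((\<lambda>s. K) has_integral I) {max a 0..min b t}" "I \<le> (b - a) * K"
    using assms(4,5) by (metis mult_right_mono diff_mono max.cobounded1 min.cobounded1
        mult_nonneg_nonneg diff_ge_0_iff_ge)
  have "{max a 0..min b t} = {a..b} \<inter> {0..t}" by auto
  then have "((\<lambda>s. if s \<in> {a..b} then K else 0) has_integral I) {0..t}"
    using I(1) has_integral_restrict_Int[of "{a..b}" "\<lambda>s. K" I "{0..t}"] by simp
  from has_integral_add[OF has_integral_const_real[of k 0 t] this]
  have "((\<lambda>s. k + (if s \<in> {a..b} then K else 0)) has_integral t * k + I) {0..t}"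
    using assms(2) by simp
  from abs_ray_le[OF assms(1,3,6) this] I(2) show ?thesis by linarith
qed

section \<open>Derivatives of ray integrals\<close>

lemma ray_has_derivative_space:
  assumes "continuous_on (strip T) (\<lambda>(x, t). F x t)" "continuous_on (strip T) (\<lambda>(x, t). F' x t)" "t \<le> T"
    and "\<And>y s. s \<in> {0..T} \<Longrightarrow> ((\<lambda>y. F y s) has_real_derivative F' y s) (at y)"
  shows "((\<lambda>x. ray \<sigma> F x t) has_real_derivative ray \<sigma> F' x t) (at x)"
  unfolding ray_def
proof -
  have "((\<lambda>x. integral (cbox 0 t) (\<lambda>s. F (x + \<sigma> * (t - s)) s)) has_field_derivative
     integral (cbox 0 t) (\<lambda>s. F' (x + \<sigma> * (t - s)) s)) (at x within UNIV)"
  proof (rule leibniz_rule_field_derivative)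
    fix y s assume "s \<in> cbox 0 t"
    then have "((\<lambda>y. F y s) has_real_derivative F' (y + \<sigma> * (t - s)) s) (at (y + \<sigma> * (t - s)))"
      using assms by auto
    then show "((\<lambda>x. F (x + \<sigma> * (t - s)) s) has_real_derivative F' (y + \<sigma> * (t - s)) s) (at y within UNIV)"
      by (simp add: DERIV_shift)
  next
    show "continuous_on (UNIV \<times> cbox 0 t) (\<lambda>(x, s). F' (x + \<sigma> * (t - s)) s)"
      unfolding split_beta
      by (rule continuous_on_strip_compose[OF assms(2)]) (use assms(3) in \<open>auto intro!: continuous_intros\<close>)
  qed (use ray_integrable[OF assms(1,3)] in auto)
  then show "((\<lambda>x. integral {0..t} (\<lambda>s. F (x + \<sigma> * (t - s)) s)) has_real_derivative
     integral {0..t} (\<lambda>s. F' (x + \<sigma> * (t - s)) s)) (at x)" by simp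
qed

text \<open>Time occurs both in the endpoint and in the integrand. In the coordinate
  \<open>x + \<sigma> * t\<close>, constant along the ray, the integrand no longer contains
  \<open>t\<close>, and the chain rule along \<open>t \<mapsto> (x + \<sigma> * t, t)\<close> gives
  the transport equation with source \<open>F\<close>.\<close>

lemma ray_has_derivative_time:
  assumes F: "continuous_on (strip T) (\<lambda>(x, t). F x t)" and F': "continuous_on (strip T) (\<lambda>(x, t). F' x t)"
    and t: "t \<in> {0..T}"
    and D: "\<And>y s. s \<in> {0..T} \<Longrightarrow> ((\<lambda>y. F y s) has_real_derivative F' y s) (at y)"
  shows "((\<lambda>t. ray \<sigma> F x t) has_vector_derivative \<sigma> * ray \<sigma> F' x t + F x t) (at t within {0..T})"
proof -
  define K where "K \<xi> t = integral {0..t} (\<lambda>s. F (\<xi> - \<sigma> * s) s)" for \<xi> t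
  have K: "ray \<sigma> F x t = K (x + \<sigma> * t) t" for x t
    unfolding ray_def K_def by (simp add: algebra_simps)
  have 1: "((\<lambda>\<xi>. K \<xi> t) has_derivative (*) (ray \<sigma> F' (\<xi> - \<sigma> * t) t)) (at \<xi> within UNIV)"
    if "t \<in> {0..T}" for \<xi> t
  proof -
    have "((\<lambda>x. ray \<sigma> F x t) has_real_derivative ray \<sigma> F' (\<xi> - \<sigma> * t) t) (at (\<xi> + (- \<sigma> * t)))"
      using ray_has_derivative_space[OF F F' _ D, of t] that by auto
    from this[THEN DERIV_shift[THEN iffD1]]
    have "((\<lambda>\<xi>. ray \<sigma> F (\<xi> + - \<sigma> * t) t) has_real_derivative ray \<sigma> F' (\<xi> - \<sigma> * t) t) (at \<xi>)" .
    then show ?thesis unfolding K has_field_derivative_def by simp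
  qed
  have 2: "((\<lambda>t. K \<xi> t) has_derivative blinfun_apply (blinfun_scaleR_left (F (\<xi> - \<sigma> * t) t))) (at t within {0..T})"
    if "t \<in> {0..T}" for \<xi> t
  proof -
    have "continuous_on {0..T} (\<lambda>s. F (\<xi> - \<sigma> * s) s)"
      by (rule continuous_on_strip_compose[OF F]) (auto intro!: continuous_intros)
    from integral_has_vector_derivative[OF this that] show ?thesis
      by (simp add: K_def has_vector_derivative_def)
  qed
  \<comment> \<open>Joint differentiability of \<open>K\<close> follows from existence of both
    partial derivatives and continuity of one of them. The time derivative is the one used here, as
    a bounded linear map.\<close>
  have "continuous_on (UNIV \<times> {0..T}) (\<lambda>z. blinfun_scaleR_left (F (fst z - \<sigma> * snd z) (snd z)))"
    by (intro bounded_linear.continuous_on[OF bounded_linear_blinfun_scaleR_left]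
          continuous_on_strip_compose[OF F]) (auto intro!: continuous_intros)
  then have 3: "continuous (at (x + \<sigma> * t, t) within UNIV \<times> {0..T}) (\<lambda>(\<xi>, t). blinfun_scaleR_left (F (\<xi> - \<sigma> * t) t))"
    using t by (simp add: continuous_on_eq_continuous_within case_prod_beta')
  have 4: "((\<lambda>(\<xi>, t). K \<xi> t) has_derivative
      (\<lambda>(h, k). ray \<sigma> F' (x + \<sigma> * t - \<sigma> * t) t * h + blinfun_apply (blinfun_scaleR_left (F (x + \<sigma> * t - \<sigma> * t) t)) k))
      (at (x + \<sigma> * t, t) within UNIV \<times> {0..T})"
    by (rule has_derivative_partialsI[OF 1 2 3]) (use t in auto)
  have 5: "((\<lambda>t. (x + \<sigma> * t, t)) has_derivative (\<lambda>h. (\<sigma> * h, h))) (at t within {0..T})"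
    by (auto intro!: derivative_eq_intros)
  from has_derivative_in_compose[OF 5 has_derivative_subset[OF 4, of "(\<lambda>t. (x + \<sigma> * t, t)) ` {0..T}"]]
  show ?thesis unfolding K has_vector_derivative_def by (auto simp: algebra_simps)
qed

subsection \<open>The integral equation\<close>

lemma ray_diff:
  assumes "continuous_on (strip T) (\<lambda>(x, t). F x t)" "continuous_on (strip T) (\<lambda>(x, t). G x t)" "t \<le> T"
  shows "ray \<sigma> (\<lambda>x t. F x t - G x t) x t = ray \<sigma> F x t - ray \<sigma> G x t"
  using ray_linear[OF assms, of \<sigma> 1 "-1"] by simp

lemma wave_diff:
  assumes "continuous_on (strip T) (\<lambda>(x, t). F x t)" "continuous_on (strip T) (\<lambda>(x, t). G x t)" "t \<le> T"
  shows "wave (\<lambda>x t. F x t - G x t) x t = wave F x t - wave G x t"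
  using assms by (simp add: wave_def ray_diff field_simps)

lemma continuous_on_strip_diff:
  fixes F G :: "real \<Rightarrow> real \<Rightarrow> real"
  assumes "continuous_on (strip T) (\<lambda>(x, t). F x t)" "continuous_on (strip T) (\<lambda>(x, t). G x t)"
  shows "continuous_on (strip T) (\<lambda>(x, t). F x t - G x t)"
  using continuous_on_diff[OF assms] by (simp add: split_beta)

text \<open>Here \<open>e\<close> stands for an error and \<open>k\<close> for the resulting error
  of the source. With rate \<open>l = 4 * L + 1\<close>, the bound \<open>l \<ge> 1\<close> lets
  \<open>ray 0 e\<close> obey the same weighted bound as \<open>e\<close>, so \<open>k\<close> is at
  most \<open>2 * L * C + \<kappa>\<close> times the weight; one more integration divides by
  \<open>l\<close>, and \<open>2 * L / l \<le> 1 / 2\<close> halves \<open>C\<close>.\<close>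

lemma abs_wave_le_weighted:
  assumes "continuous_on (strip T) (\<lambda>(x, t). k x t)" "continuous_on (strip T) (\<lambda>(x, t). e x t)"
    and "L \<ge> 0" "C \<ge> 0" "\<kappa> \<ge> 0" "t \<in> {0..T}"
    and k: "\<And>x t. t \<in> {0..T} \<Longrightarrow> \<bar>k x t\<bar> \<le> L * (\<bar>e x t\<bar> + \<bar>ray 0 e x t\<bar>) + \<kappa>"
    and e: "\<And>x t. t \<in> {0..T} \<Longrightarrow> \<bar>e x t\<bar> \<le> C * exp ((4 * L + 1) * t)"
  shows "\<bar>wave k x t\<bar> \<le> (C / 2 + \<kappa>) * exp ((4 * L + 1) * t)"
proof -
  define l where "l = 4 * L + 1"
  have l: "l \<ge> 1" "2 * L / l \<le> 1 / 2" using assms(3) by (auto simp: l_def divide_simps)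
  have k': "\<bar>k y s\<bar> \<le> (2 * L * C + \<kappa>) * exp (l * s)" if "s \<in> {0..t}" for y s
  proof -
    have s: "s \<in> {0..T}" using that assms(6) by auto
    have "\<bar>ray 0 e y s\<bar> \<le> C / l * exp (l * s)"
      by (rule abs_ray_le_exp[OF assms(2)]) (use s e l assms(4) in \<open>auto simp: l_def\<close>)
    also have "\<dots> \<le> C * exp (l * s)"
      using l assms(4) by (intro mult_right_mono) (auto simp: divide_simps mult_le_cancel_left1)
    finally have "\<bar>e y s\<bar> + \<bar>ray 0 e y s\<bar> \<le> 2 * (C * exp (l * s))"
      using e[OF s, of y] by (simp add: l_def)
    then have "\<bar>k y s\<bar> \<le> L * (2 * (C * exp (l * s))) + \<kappa>"
      using k[OF s, of y] assms(3) by (meson add_right_mono mult_left_mono order_trans)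
    also have "\<kappa> \<le> \<kappa> * exp (l * s)"
      using assms(5) l(1) s by (auto simp: mult_le_cancel_left1)
    finally show ?thesis by (simp add: algebra_simps)
  qed
  have r: "\<bar>ray \<sigma> k x t\<bar> \<le> (C / 2 + \<kappa>) * exp (l * t)" for \<sigma>
  proof -
    have "\<bar>ray \<sigma> k x t\<bar> \<le> (2 * L * C + \<kappa>) / l * exp (l * t)"
      by (rule abs_ray_le_exp[OF assms(1)]) (use k' l assms in auto)
    moreover have "(2 * L * C + \<kappa>) / l \<le> C / 2 + \<kappa>"
    proof -
      have "(2 * L * C + \<kappa>) / l = (2 * L / l) * C + \<kappa> / l" by (simp add: add_divide_distrib)
      also have "\<dots> \<le> 1 / 2 * C + \<kappa>"
        using l assms by (intro add_mono mult_right_mono) (auto simp: divide_simps mult_le_cancel_left1)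
      finally show ?thesis by simp
    qed
    ultimately show ?thesis by (meson exp_ge_zero mult_right_mono order_trans)
  qed
  show ?thesis using abs_wave_le[OF r r] unfolding l_def .
qed

text \<open>The weighted supremum \<open>C\<close> of the error satisfies
  \<open>C \<le> C / 2 + \<kappa> + \<rho>\<close>, and half of it is absorbed on the left. The
  bound \<open>M\<close> only makes this supremum finite; it does not enter the estimate.\<close>

lemma wave_gronwall:
  assumes "continuous_on (strip T) (\<lambda>(x, t). k x t)" "continuous_on (strip T) (\<lambda>(x, t). e x t)"
    and "L \<ge> 0" "\<kappa> \<ge> 0"
    and bdd: "\<And>x t. t \<in> {0..T} \<Longrightarrow> \<bar>e x t\<bar> \<le> M"
    and eq: "\<And>x t. t \<in> {0..T} \<Longrightarrow> \<bar>e x t\<bar> \<le> \<rho> + \<bar>wave k x t\<bar>"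
    and k: "\<And>x t. t \<in> {0..T} \<Longrightarrow> \<bar>k x t\<bar> \<le> L * (\<bar>e x t\<bar> + \<bar>ray 0 e x t\<bar>) + \<kappa>"
    and "t \<in> {0..T}"
  shows "\<bar>e x t\<bar> \<le> 2 * (\<rho> + \<kappa>) * exp ((4 * L + 1) * T)"
proof -
  define l where "l = 4 * L + 1"
  have l: "l > 0" using assms(3) by (auto simp: l_def)
  define q where "q = (\<lambda>(x, t). \<bar>e x t\<bar> / exp (l * t))"
  define C where "C = (SUP z\<in>strip T. q z)"
  have ne: "strip T \<noteq> {}" using assms(8) by (auto simp: strip_def)
  have "q z \<le> M" if z: "z \<in> strip T" for z
  proof -
    obtain x s where z: "z = (x, s)" "s \<in> {0..T}" using z by (auto simp: strip_def)
    have "\<bar>e x s\<bar> / exp (l * s) \<le> \<bar>e x s\<bar>"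
      using z l by (auto simp: divide_simps mult_le_cancel_left1)
    with bdd[OF z(2), of x] show ?thesis by (simp add: z q_def)
  qed
  then have bd: "bdd_above (q ` strip T)" by (rule bdd_aboveI2)
  have C: "\<bar>e x s\<bar> \<le> C * exp (l * s)" if "s \<in> {0..T}" for x s
  proof -
    have "q (x, s) \<le> C" unfolding C_def
      by (rule cSUP_upper[OF _ bd]) (use that in \<open>simp add: strip_def\<close>)
    then show ?thesis by (simp add: q_def divide_simps)
  qed
  have C0: "C \<ge> 0" using C[OF assms(8), of x] by (smt (verit) zero_le_mult_iff exp_gt_zero)
  have "C \<le> C / 2 + \<kappa> + \<rho>" unfolding C_def
  proof (rule cSUP_least[OF ne])
    fix z assume "z \<in> strip T"
    then obtain x s where z: "z = (x, s)" "s \<in> {0..T}" by (auto simp: strip_def)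
    have w: "\<bar>wave k x s\<bar> \<le> (C / 2 + \<kappa>) * exp (l * s)" unfolding l_def
      by (rule abs_wave_le_weighted[OF assms(1,2,3) C0 assms(4) z(2) k]) (use C in \<open>auto simp: l_def\<close>)
    \<comment> \<open>The sign is read off from the inequality at time 0, where
      \<open>wave k\<close> vanishes.\<close>
    have "\<rho> \<ge> 0"
    proof -
      have "wave k x 0 = 0" by (simp add: wave_def ray_def)
      with eq[of 0 x] z(2) show ?thesis by fastforce
    qed
    then have "\<rho> \<le> \<rho> * exp (l * s)" using l z(2) by (auto simp: mult_le_cancel_left1)
    with w eq[OF z(2), of x] have "\<bar>e x s\<bar> \<le> (C / 2 + \<kappa> + \<rho>) * exp (l * s)"
      by (simp add: algebra_simps)
    then have "q z \<le> C / 2 + \<kappa> + \<rho>"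
      by (simp add: q_def z pos_divide_le_eq)
    then show "q z \<le> (SUP z\<in>strip T. q z) / 2 + \<kappa> + \<rho>" by (simp only: C_def)
  qed
  then have "C \<le> 2 * (\<rho> + \<kappa>)" by simp
  then have "C * exp (l * t) \<le> 2 * (\<rho> + \<kappa>) * exp (l * T)"
    using C0 assms(8) l by (intro mult_mono) auto
  with C[OF assms(8), of x] show ?thesis by (simp add: l_def)
qed

text \<open>Successive iterates halve their weighted distance, so they converge uniformly on the
  strip for every \<open>L\<close>. The set \<open>X\<close> is left abstract because it is used
  twice: with decay conditions for the nonlinear equation, and with mere boundedness for the
  linearised one. The equation is claimed on the strip only, since values outside it are
  unconstrained.\<close>

lemma wave_fixed_point:
  fixes X :: "(real \<Rightarrow> real \<Rightarrow> real) set"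
  assumes L: "L \<ge> 0" and w0: "w0 \<in> X"
    and cont: "\<And>w. w \<in> X \<Longrightarrow> continuous_on (strip T) (\<lambda>(x, t). w x t)"
    and contN: "\<And>w. w \<in> X \<Longrightarrow> continuous_on (strip T) (\<lambda>(x, t). N w x t)"
    and bdd: "\<And>w. w \<in> X \<Longrightarrow> \<exists>M. \<forall>x. \<forall>t\<in>{0..T}. \<bar>w x t\<bar> \<le> M"
    and inv: "\<And>w. w \<in> X \<Longrightarrow> (\<lambda>x t. \<phi> x t + wave (N w) x t) \<in> X"
    and lip: "\<And>w w' x t. w \<in> X \<Longrightarrow> w' \<in> X \<Longrightarrow> t \<in> {0..T} \<Longrightarrow>
        \<bar>N w x t - N w' x t\<bar> \<le> L * (\<bar>w x t - w' x t\<bar> + \<bar>ray 0 w x t - ray 0 w' x t\<bar>)"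
    and closed: "\<And>ws w. (\<And>n. ws n \<in> X) \<Longrightarrow>
        uniform_limit (strip T) (\<lambda>n (x, t). ws n x t) (\<lambda>(x, t). w x t) sequentially \<Longrightarrow> w \<in> X"
  shows "\<exists>w\<in>X. \<forall>x. \<forall>t\<in>{0..T}. w x t = \<phi> x t + wave (N w) x t"
proof -
  define \<Phi> where "\<Phi> w = (\<lambda>x t. \<phi> x t + wave (N w) x t)" for w
  define E where "E t = exp ((4 * L + 1) * t)" for t
  have E: "1 \<le> E t" "E t \<le> E T" if "t \<in> {0..T}" for t
    using that L by (auto simp: E_def intro!: mult_left_mono)
  have contr: "\<bar>\<Phi> w x t - \<Phi> w' x t\<bar> \<le> C / 2 * E t"
    if w: "w \<in> X" "w' \<in> X" and C: "C \<ge> 0" "\<And>x t. t \<in> {0..T} \<Longrightarrow> \<bar>w x t - w' x t\<bar> \<le> C * E t"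
      and t: "t \<in> {0..T}" for w w' C x t
  proof -
    have tT: "t \<le> T" using t by simp
    have "\<bar>wave (\<lambda>x t. N w x t - N w' x t) x t\<bar> \<le> (C / 2 + 0) * exp ((4 * L + 1) * t)"
      by (rule abs_wave_le_weighted[OF continuous_on_strip_diff[OF contN contN]
            continuous_on_strip_diff[OF cont[OF w(1)] cont[OF w(2)]]])
         (use w C t L lip in \<open>auto simp: E_def ray_diff[OF cont cont]\<close>)
    then show ?thesis
      using wave_diff[OF contN[OF w(1)] contN[OF w(2)] tT, of x] by (simp add: \<Phi>_def E_def)
  qed
  define ws where "ws n = (\<Phi> ^^ n) w0" for n
  have wsX: "ws n \<in> X" for n
    unfolding ws_def by (induction n) (auto simp: w0 inv \<Phi>_def)
  have wsS: "ws (Suc n) = \<Phi> (ws n)" for n by (simp add: ws_def)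
  obtain M0 M1 where M: "\<And>x t. t \<in> {0..T} \<Longrightarrow> \<bar>ws 0 x t\<bar> \<le> M0" "\<And>x t. t \<in> {0..T} \<Longrightarrow> \<bar>ws 1 x t\<bar> \<le> M1"
    using bdd[OF wsX[of 0]] bdd[OF wsX[of 1]] by metis
  define D where "D = max 0 (M0 + M1)"
  have d: "\<bar>ws (Suc n) x t - ws n x t\<bar> \<le> D / 2 ^ n * E t" if "t \<in> {0..T}" for n x t
    using that
  proof (induction n arbitrary: x t)
    case 0
    have "\<bar>ws (Suc 0) x t - ws 0 x t\<bar> \<le> D"
      using M(1)[OF 0, of x] M(2)[OF 0, of x] by (auto simp: D_def)
    also have "D \<le> D * E t" using E(1)[OF 0] by (simp add: D_def mult_le_cancel_left1)
    finally show ?case by simp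
  next
    case (Suc n)
    have "\<bar>\<Phi> (ws (Suc n)) x t - \<Phi> (ws n) x t\<bar> \<le> D / 2 ^ n / 2 * E t"
      by (rule contr) (use Suc wsX in \<open>auto simp: D_def\<close>)
    then show ?case by (simp add: wsS field_simps)
  qed
  define f where "f n = (\<lambda>(x, t). ws (Suc n) x t - ws n x t)" for n
  \<comment> \<open>The increments \<open>f n\<close> telescope, which turns convergence of the
    iterates into convergence of a series dominated by a geometric one.\<close>
  define w where "w x t = ws 0 x t + (\<Sum>n. f n (x, t))" for x t
  have "uniform_limit (strip T) (\<lambda>n z. \<Sum>i<n. f i z) (\<lambda>z. \<Sum>i. f i z) sequentially"
  proof (rule Weierstrass_m_test)
    fix n z assume "z \<in> strip T"
    then obtain x t where z: "z = (x, t)" "t \<in> {0..T}" by (auto simp: strip_def)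
    have "\<bar>ws (Suc n) x t - ws n x t\<bar> \<le> D / 2 ^ n * E t" by (rule d[OF z(2)])
    also have "\<dots> \<le> D / 2 ^ n * E T" using E(2)[OF z(2)] by (intro mult_left_mono) (auto simp: D_def)
    finally show "norm (f n z) \<le> D * E T * (1 / 2) ^ n" by (simp add: f_def z field_simps)
  qed (intro summable_mult summable_geometric, simp)
  then have "uniform_limit (strip T) (\<lambda>n z. (\<lambda>(x, t). ws 0 x t) z + (\<Sum>i<n. f i z))
      (\<lambda>z. (\<lambda>(x, t). ws 0 x t) z + (\<Sum>i. f i z)) sequentially"
    by (intro uniform_limit_add uniform_limit_const)
  moreover have "(\<lambda>n z. (\<lambda>(x, t). ws 0 x t) z + (\<Sum>i<n. f i z)) = (\<lambda>n (x, t). ws n x t)"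
    using sum_lessThan_telescope[of "\<lambda>i. ws i _ _"] by (auto simp: fun_eq_iff f_def)
  moreover have "(\<lambda>z. (\<lambda>(x, t). ws 0 x t) z + (\<Sum>i. f i z)) = (\<lambda>(x, t). w x t)"
    by (auto simp: fun_eq_iff w_def)
  ultimately have ul: "uniform_limit (strip T) (\<lambda>n (x, t). ws n x t) (\<lambda>(x, t). w x t) sequentially"
    by simp
  have wX: "w \<in> X" by (rule closed[OF wsX ul])
  moreover have "w x t = \<Phi> w x t" if t: "t \<in> {0..T}" for x t
  proof -
    have "\<bar>w x t - \<Phi> w x t\<bar> \<le> 0"
    proof (rule field_le_epsilon)
      fix \<epsilon> :: real assume "\<epsilon> > 0"
      \<comment> \<open>The distance from \<open>w\<close> to \<open>ws (Suc n0)\<close> is below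
        \<open>\<eta>\<close>, and from there to \<open>\<Phi> w\<close> it is at most
        \<open>\<eta> * E T\<close>; this choice makes the two add up to
        \<open>\<epsilon>\<close>.\<close>
      define \<eta> where "\<eta> = \<epsilon> / (1 + E T)"
      have ET: "E T > 0" by (simp add: E_def)
      have \<eta>: "\<eta> > 0" using \<open>\<epsilon> > 0\<close> ET by (simp add: \<eta>_def)
      obtain n0 where n0: "\<And>n y s. n \<ge> n0 \<Longrightarrow> s \<in> {0..T} \<Longrightarrow> \<bar>ws n y s - w y s\<bar> < \<eta>"
        using uniform_limitD[OF ul \<eta>] unfolding eventually_sequentially
        by (fastforce simp: strip_def dist_real_def)
      have "\<bar>\<Phi> (ws n0) x t - \<Phi> w x t\<bar> \<le> \<eta> / 2 * E t"
      proof (rule contr[OF wsX wX _ _ t])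
        fix y s assume "s \<in> {0..T}"
        then show "\<bar>ws n0 y s - w y s\<bar> \<le> \<eta> * E s"
          using n0[of n0 s y] E(1)[of s] \<eta> by (smt (verit) mult_le_cancel_left1 order_refl)
      qed (use \<eta> in simp)
      moreover have "\<eta> / 2 * E t \<le> \<eta> * E T"
        using E(2)[OF t] E(1)[OF t] \<eta> by (intro mult_mono) auto
      moreover have "\<bar>ws (Suc n0) x t - w x t\<bar> < \<eta>" using n0 t by simp
      ultimately have "\<bar>w x t - \<Phi> w x t\<bar> \<le> \<eta> + \<eta> * E T" unfolding wsS by linarith
      also have "\<dots> = \<eta> * (1 + E T)" by (simp add: algebra_simps)
      also have "\<dots> = \<epsilon>" using ET by (simp add: \<eta>_def)
      finally show "\<bar>w x t - \<Phi> w x t\<bar> \<le> 0 + \<epsilon>" by simp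
    qed
    then show ?thesis by simp
  qed
  ultimately show ?thesis unfolding \<Phi>_def by blast
qed

subsection \<open>Differentiability in space\<close>

text \<open>The mean value inequality is applied to \<open>\<phi> z - \<phi>' x * z\<close>, whose
  derivative is small near \<open>x\<close>. The point is that \<open>\<delta>\<close> does not
  depend on \<open>x\<close>, as needed for estimates in the supremum norm.\<close>

lemma uniform_first_order_expansion:
  fixes \<phi> \<phi>' :: "real \<Rightarrow> real"
  assumes "convex S" "\<And>x. (\<phi> has_real_derivative \<phi>' x) (at x)"
    and "uniformly_continuous_on S \<phi>'" "\<eta> > 0"
  shows "\<exists>\<delta>>0. \<forall>x\<in>S. \<forall>y\<in>S. \<bar>y - x\<bar> < \<delta> \<longrightarrow> \<bar>\<phi> y - \<phi> x - \<phi>' x * (y - x)\<bar> \<le> \<eta> * \<bar>y - x\<bar>"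
proof -
  obtain \<delta> where \<delta>: "\<delta> > 0" "\<And>x y. x \<in> S \<Longrightarrow> y \<in> S \<Longrightarrow> \<bar>y - x\<bar> < \<delta> \<Longrightarrow> \<bar>\<phi>' y - \<phi>' x\<bar> < \<eta>"
    using assms(3,4) unfolding uniformly_continuous_on_def dist_real_def by meson
  have "\<bar>\<phi> y - \<phi> x - \<phi>' x * (y - x)\<bar> \<le> \<eta> * \<bar>y - x\<bar>"
    if xy: "x \<in> S" "y \<in> S" "\<bar>y - x\<bar> < \<delta>" for x y
  proof -
    have "norm ((\<phi> y - \<phi>' x * y) - (\<phi> x - \<phi>' x * x)) \<le> \<eta> * norm (y - x)"
    proof (rule field_differentiable_bound[of "closed_segment x y" _ "\<lambda>z. \<phi>' z - \<phi>' x"])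
      fix z assume z: "z \<in> closed_segment x y"
      show "((\<lambda>z. \<phi> z - \<phi>' x * z) has_real_derivative \<phi>' z - \<phi>' x) (at z within closed_segment x y)"
        by (rule has_field_derivative_at_within) (auto intro!: derivative_eq_intros assms(2))
      have "z \<in> S" using z xy assms(1) closed_segment_subset by blast
      moreover have "\<bar>z - x\<bar> < \<delta>"
        using z xy(3) by (auto simp: closed_segment_eq_real_ivl split: if_splits)
      ultimately show "norm (\<phi>' z - \<phi>' x) \<le> \<eta>"
        using \<delta>(2)[of x z] xy by simp
    qed auto
    then show ?thesis by (simp add: algebra_simps)
  qed
  with \<delta>(1) show ?thesis by blast
qed

lemma lipschitz_from_derivative:
  fixes \<phi> \<phi>' :: "real \<Rightarrow> real"
  assumes "convex S" "\<And>x. (\<phi> has_real_derivative \<phi>' x) (at x)"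
    and "\<And>x. x \<in> S \<Longrightarrow> \<bar>\<phi>' x\<bar> \<le> B" "x \<in> S" "y \<in> S"
  shows "\<bar>\<phi> y - \<phi> x\<bar> \<le> B * \<bar>y - x\<bar>"
  using field_differentiable_bound[OF assms(1) has_field_derivative_at_within[OF assms(2)], of B y x] assms
  by auto

lemma continuous_bounded_Icc:
  fixes \<phi> :: "real \<Rightarrow> real"
  assumes "continuous_on UNIV \<phi>"
  obtains L where "\<And>x. x \<in> {a..b} \<Longrightarrow> \<bar>\<phi> x\<bar> \<le> L"
proof -
  have "bounded (\<phi> ` {a..b})"
    using assms by (auto intro!: compact_imp_bounded compact_continuous_image elim: continuous_on_subset)
  then obtain L where "\<forall>y\<in>\<phi> ` {a..b}. norm y \<le> L" unfolding bounded_iff by blast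
  then show thesis by (intro that[of L]) auto
qed

text \<open>Translation invariance in space: it is the reason why difference quotients of a solution
  satisfy an integral equation of the same kind.\<close>

lemma ray_shift: "ray \<sigma> F (x + h) t = ray \<sigma> (\<lambda>x t. F (x + h) t) x t"
  unfolding ray_def by (simp add: ac_simps)

lemma wave_shift: "wave F (x + h) t = wave (\<lambda>x t. F (x + h) t) x t"
  unfolding wave_def by (simp add: ray_shift)

lemma wave_linear:
  assumes "continuous_on (strip T) (\<lambda>(x, t). F x t)" "continuous_on (strip T) (\<lambda>(x, t). G x t)" "t \<le> T"
  shows "wave (\<lambda>x t. a * F x t + b * G x t) x t = a * wave F x t + b * wave G x t"
  using assms by (simp add: wave_def ray_linear field_simps)

lemma abs_ray_le_strip_const:
  assumes "continuous_on (strip T) (\<lambda>(x, t). F x t)" "t \<in> {0..T}"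
    and "\<And>x t. t \<in> {0..T} \<Longrightarrow> \<bar>F x t\<bar> \<le> C"
  shows "\<bar>ray \<sigma> F x t\<bar> \<le> T * C"
proof -
  have "\<bar>F 0 t\<bar> \<le> C" by (rule assms(3)[OF assms(2)])
  then have "t * C \<le> T * C" using assms(2) by (intro mult_right_mono) auto
  moreover have "\<bar>ray \<sigma> F x t\<bar> \<le> t * C"
    by (rule abs_ray_le_const[OF assms(1)]) (use assms in auto)
  ultimately show ?thesis by simp
qed

lemma abs_wave_le_const:
  assumes "continuous_on (strip T) (\<lambda>(x, t). F x t)" "t \<in> {0..T}"
    and "\<And>x t. t \<in> {0..T} \<Longrightarrow> \<bar>F x t\<bar> \<le> C"
  shows "\<bar>wave F x t\<bar> \<le> T * C"
  by (intro abs_wave_le abs_ray_le_strip_const assms)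

lemma continuous_on_strip_linear:
  fixes F G :: "real \<Rightarrow> real \<Rightarrow> real"
  assumes "continuous_on (strip T) (\<lambda>(x, t). F x t)" "continuous_on (strip T) (\<lambda>(x, t). G x t)"
  shows "continuous_on (strip T) (\<lambda>(x, t). a * F x t + b * G x t)"
  using assms unfolding split_beta by (intro continuous_intros)

lemma continuous_on_strip_shift:
  assumes "continuous_on (strip T) (\<lambda>(x, t). F x t)"
  shows "continuous_on (strip T) (\<lambda>(x, t). F (x + h) t)"
  unfolding split_beta
  by (rule continuous_on_strip_compose[OF assms]) (auto simp: strip_def intro!: continuous_intros)

text \<open>The derivative is constructed as the solution of the linearised integral equation;
  the Gronwall estimate shows that the difference quotients converge to it uniformly.\<close>

lemma wave_solution_space_derivative:
  fixes w :: "real \<Rightarrow> real \<Rightarrow> real" and \<alpha> \<beta> f a b \<alpha>' \<beta>' f' a' b' :: "real \<Rightarrow> real"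
  defines "U \<equiv> \<lambda>w x t. f x + ray 0 w x t"
  assumes w: "continuous_on (strip T) (\<lambda>(x, t). w x t)" "\<And>x t. t \<in> {0..T} \<Longrightarrow> \<bar>w x t\<bar> \<le> M"
    and \<alpha>: "\<And>x. (\<alpha> has_real_derivative \<alpha>' x) (at x)" "uniformly_continuous_on UNIV \<alpha>'" "\<And>x. \<bar>\<alpha>' x\<bar> \<le> \<Lambda>"
    and \<beta>: "\<And>x. (\<beta> has_real_derivative \<beta>' x) (at x)" "uniformly_continuous_on UNIV \<beta>'" "\<And>x. \<bar>\<beta>' x\<bar> \<le> \<Lambda>"
    and f: "\<And>x. (f has_real_derivative f' x) (at x)" "uniformly_continuous_on UNIV f'" "\<And>x. \<bar>f' x\<bar> \<le> \<Lambda>" "\<And>x. \<bar>f x\<bar> \<le> M"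
    and a: "\<And>x. (a has_real_derivative a' x) (at x)" "continuous_on UNIV a'"
    and b: "\<And>x. (b has_real_derivative b' x) (at x)" "continuous_on UNIV b'"
    and T: "T \<ge> 0"
    and eq: "\<And>x t. t \<in> {0..T} \<Longrightarrow> w x t = (\<alpha> (x + t) + \<beta> (x - t)) / 2 + wave (\<lambda>x t. a (w x t) + b (U w x t)) x t"
  obtains v where "continuous_on (strip T) (\<lambda>(x, t). v x t)"
    and "\<And>x t. t \<in> {0..T} \<Longrightarrow> ((\<lambda>y. w y t) has_real_derivative v x t) (at x)"
    and "\<And>x t. t \<in> {0..T} \<Longrightarrow> v x t = (\<alpha>' (x + t) + \<beta>' (x - t)) / 2
           + wave (\<lambda>x t. a' (w x t) * v x t + b' (U w x t) * (f' x + ray 0 v x t)) x t"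
proof -
  have cont: "continuous_on UNIV \<alpha>" "continuous_on UNIV \<beta>" "continuous_on UNIV f" "continuous_on UNIV a" "continuous_on UNIV b"
    by (rule DERIV_continuous_on[OF \<alpha>(1)] DERIV_continuous_on[OF \<beta>(1)] DERIV_continuous_on[OF f(1)]
          DERIV_continuous_on[OF a(1)] DERIV_continuous_on[OF b(1)])+
  have cont': "continuous_on UNIV \<alpha>'" "continuous_on UNIV \<beta>'" "continuous_on UNIV f'"
    using \<alpha>(2) \<beta>(2) f(2) by (auto intro: uniformly_continuous_imp_continuous)
  have M0: "M \<ge> 0" "\<Lambda> \<ge> 0" using f(4)[of 0] f(3)[of 0] by auto
  \<comment> \<open>A common bound for \<open>w\<close> and \<open>U w\<close>. Only the values of
    \<open>a'\<close> and \<open>b'\<close> on the compact interval from \<open>-K\<close> to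
    \<open>K\<close> matter, where these functions are bounded and uniformly continuous.\<close>
  define K where "K = M + T * M"
  have K: "M \<le> K" using M0 T by (simp add: K_def)
  have U: "\<bar>U w x t\<bar> \<le> K" if "t \<in> {0..T}" for x t
    using abs_ray_le_strip_const[OF w(1) that w(2), of 0 x] f(4)[of x] by (simp add: K_def U_def)
  have w_mem: "w x t \<in> {-K..K}" "U w x t \<in> {-K..K}" if "t \<in> {0..T}" for x t
    using w(2)[OF that, of x] K U[OF that, of x] by auto
  have ucab: "uniformly_continuous_on {-K..K} a'" "uniformly_continuous_on {-K..K} b'"
    using a(2) b(2) by (auto intro!: compact_uniformly_continuous elim: continuous_on_subset)
  obtain L1 L2 where L12: "\<And>z. z \<in> {-K..K} \<Longrightarrow> \<bar>a' z\<bar> \<le> L1" "\<And>z. z \<in> {-K..K} \<Longrightarrow> \<bar>b' z\<bar> \<le> L2"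
    using continuous_bounded_Icc[OF a(2)] continuous_bounded_Icc[OF b(2)] by metis
  define L where "L = max L1 L2"
  have L: "\<bar>a' z\<bar> \<le> L" "\<bar>b' z\<bar> \<le> L" if "z \<in> {-K..K}" for z
    using L12[OF that] by (auto simp: L_def)
  have L0: "L \<ge> 0" using L(1)[OF w_mem(1)[of 0 0]] T by auto
  have cU: "continuous_on (strip T) (\<lambda>(x, t). U v x t)" if "continuous_on (strip T) (\<lambda>(x, t). v x t)" for v
    using continuous_on_ray[OF that, of 0]
    unfolding U_def split_beta
    by (intro continuous_intros continuous_on_compose2[OF cont(3)]) auto
  define F where "F = (\<lambda>x t. a (w x t) + b (U w x t))"
  have cF: "continuous_on (strip T) (\<lambda>(x, t). F x t)"
    using w(1) cU[OF w(1)] unfolding F_def split_beta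
    by (intro continuous_intros continuous_on_compose2[OF cont(4)] continuous_on_compose2[OF cont(5)]) auto
  \<comment> \<open>The formal space derivative of the source \<open>F\<close>, with
    \<open>v\<close> in place of the derivative of \<open>w\<close> and
    \<open>f' x + ray 0 v x t\<close> in place of that of \<open>U w\<close>.\<close>
  define N where "N = (\<lambda>v x t. a' (w x t) * v x t + b' (U w x t) * (f' x + ray 0 v x t))"
  have cN: "continuous_on (strip T) (\<lambda>(x, t). N v x t)" if v: "continuous_on (strip T) (\<lambda>(x, t). v x t)" for v
    using w(1) cU[OF w(1)] v continuous_on_ray[OF v, of 0] unfolding N_def split_beta
    by (intro continuous_intros continuous_on_compose2[OF a(2)] continuous_on_compose2[OF b(2)]
        continuous_on_compose2[OF cont'(3)]) auto
  define \<phi> where "\<phi> = (\<lambda>x t. (\<alpha>' (x + t) + \<beta>' (x - t)) / 2)"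
  have c\<phi>: "continuous_on (strip T) (\<lambda>(x, t). \<phi> x t)"
    unfolding \<phi>_def split_beta
    by (intro continuous_intros continuous_on_compose2[OF cont'(1)] continuous_on_compose2[OF cont'(2)]) auto
  define X where "X = {v :: real \<Rightarrow> real \<Rightarrow> real. continuous_on (strip T) (\<lambda>(x, t). v x t) \<and> (\<exists>M. \<forall>x. \<forall>t\<in>{0..T}. \<bar>v x t\<bar> \<le> M)}"
  have "\<exists>v\<in>X. \<forall>x. \<forall>t\<in>{0..T}. v x t = \<phi> x t + wave (N v) x t"
  proof (rule wave_fixed_point[OF L0])
    show "(\<lambda>x t. 0) \<in> X" by (auto simp: X_def split_beta)
  next
    fix v assume vX: "v \<in> X"
    then have v: "continuous_on (strip T) (\<lambda>(x, t). v x t)" by (simp add: X_def)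
    then show "continuous_on (strip T) (\<lambda>(x, t). v x t)" "continuous_on (strip T) (\<lambda>(x, t). N v x t)"
      by (rule_tac cN | simp)+
    show "\<exists>M. \<forall>x. \<forall>t\<in>{0..T}. \<bar>v x t\<bar> \<le> M" using vX by (simp add: X_def)
    then obtain V where V: "\<And>x t. t \<in> {0..T} \<Longrightarrow> \<bar>v x t\<bar> \<le> V" by blast
    have "\<bar>N v x t\<bar> \<le> L * V + L * (\<Lambda> + T * V)" if t: "t \<in> {0..T}" for x t
    proof -
      have "\<bar>f' x + ray 0 v x t\<bar> \<le> \<Lambda> + T * V"
        using f(3)[of x] abs_ray_le_strip_const[OF v t V, of 0 x] by linarith
      then have "\<bar>b' (U w x t) * (f' x + ray 0 v x t)\<bar> \<le> L * (\<Lambda> + T * V)"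
        unfolding abs_mult using L(2)[OF w_mem(2)[OF t]] L0 by (intro mult_mono) auto
      moreover have "\<bar>a' (w x t) * v x t\<bar> \<le> L * V"
        unfolding abs_mult using L(1)[OF w_mem(1)[OF t]] V[OF t] L0 by (intro mult_mono) auto
      ultimately show ?thesis unfolding N_def by linarith
    qed
    then have "\<bar>wave (N v) x t\<bar> \<le> T * (L * V + L * (\<Lambda> + T * V))" if "t \<in> {0..T}" for x t
      using abs_wave_le_const[OF cN[OF v] that] by blast
    moreover have "\<bar>\<phi> x t\<bar> \<le> \<Lambda>" for x t
      using \<alpha>(3)[of "x + t"] \<beta>(3)[of "x - t"] by (auto simp: \<phi>_def abs_le_iff)
    ultimately have "\<bar>\<phi> x t + wave (N v) x t\<bar> \<le> \<Lambda> + T * (L * V + L * (\<Lambda> + T * V))" if "t \<in> {0..T}" for x t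
      using that by (meson abs_triangle_ineq add_mono order_trans)
    moreover have "continuous_on (strip T) (\<lambda>(x, t). \<phi> x t + wave (N v) x t)"
      using continuous_on_add[OF c\<phi> continuous_on_wave[OF cN[OF v]]] by (simp add: split_beta)
    ultimately show "(\<lambda>x t. \<phi> x t + wave (N v) x t) \<in> X" unfolding X_def by blast
  next
    fix v v' x t assume t: "t \<in> {0..T}"
    have "N v x t - N v' x t = a' (w x t) * (v x t - v' x t) + b' (U w x t) * (ray 0 v x t - ray 0 v' x t)"
      by (simp add: N_def algebra_simps)
    also have "\<bar>\<dots>\<bar> \<le> L * \<bar>v x t - v' x t\<bar> + L * \<bar>ray 0 v x t - ray 0 v' x t\<bar>"
      using L(1)[OF w_mem(1)[OF t]] L(2)[OF w_mem(2)[OF t]]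
      by (intro order_trans[OF abs_triangle_ineq] add_mono) (auto simp: abs_mult intro!: mult_right_mono)
    finally show "\<bar>N v x t - N v' x t\<bar> \<le> L * (\<bar>v x t - v' x t\<bar> + \<bar>ray 0 v x t - ray 0 v' x t\<bar>)"
      by (simp add: algebra_simps)
  next
    fix vs v assume vs: "\<And>n. vs n \<in> X"
      and ul: "uniform_limit (strip T) (\<lambda>n (x, t). vs n x t) (\<lambda>(x, t). v x t) sequentially"
    have "continuous_on (strip T) (\<lambda>(x, t). v x t)"
      by (rule uniform_limit_theorem[OF _ ul]) (use vs in \<open>auto simp: X_def\<close>)
    moreover have "\<exists>M. \<forall>x. \<forall>t\<in>{0..T}. \<bar>v x t\<bar> \<le> M"
    proof -
      obtain n where n: "\<And>x t. t \<in> {0..T} \<Longrightarrow> \<bar>vs n x t - v x t\<bar> < 1"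
        using uniform_limitD[OF ul, of 1] unfolding eventually_sequentially
        by (fastforce simp: strip_def dist_real_def)
      obtain V where V: "\<And>x t. t \<in> {0..T} \<Longrightarrow> \<bar>vs n x t\<bar> \<le> V" using vs[of n] unfolding X_def by blast
      have "\<bar>v x t\<bar> \<le> V + 1" if "t \<in> {0..T}" for x t
        using n[OF that, of x] V[OF that, of x] by linarith
      then show ?thesis by blast
    qed
    ultimately show "v \<in> X" by (simp add: X_def)
  qed
  then obtain v V where v: "continuous_on (strip T) (\<lambda>(x, t). v x t)"
    and V: "\<And>x t. t \<in> {0..T} \<Longrightarrow> \<bar>v x t\<bar> \<le> V"
    and veq: "\<And>x t. t \<in> {0..T} \<Longrightarrow> v x t = \<phi> x t + wave (N v) x t"
    unfolding X_def by blast
  define E where "E = exp ((4 * L + 1) * T)"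
  have E0: "E > 0" by (simp add: E_def)
  \<comment> \<open>The Gronwall constant for the increment of \<open>w\<close> over a step
    \<open>h\<close>, divided by \<open>\<bar>h\<bar>\<close>: the increments of
    \<open>\<alpha>\<close> and \<open>\<beta>\<close> give
    \<open>\<rho> = \<Lambda> * \<bar>h\<bar>\<close>, and that of \<open>f\<close>, through
    \<open>b\<close>, gives \<open>\<kappa> = L * \<Lambda> * \<bar>h\<bar>\<close>.\<close>
  define K1 where "K1 = 2 * (\<Lambda> + L * \<Lambda>) * E"
  define K2 where "K2 = \<Lambda> + T * K1"
  have ray_w_diff: "ray 0 w (x + h) t - ray 0 w x t = ray 0 (\<lambda>x t. w (x + h) t - w x t) x t" if "t \<in> {0..T}" for x h t
    unfolding ray_shift using ray_diff[OF continuous_on_strip_shift[OF w(1)] w(1)] that by simp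
  have lip\<Lambda>: "\<bar>\<alpha> (x + h) - \<alpha> x\<bar> \<le> \<Lambda> * \<bar>h\<bar>" "\<bar>\<beta> (x + h) - \<beta> x\<bar> \<le> \<Lambda> * \<bar>h\<bar>" "\<bar>f (x + h) - f x\<bar> \<le> \<Lambda> * \<bar>h\<bar>" for x h
    using lipschitz_from_derivative[of UNIV \<alpha> \<alpha>' \<Lambda> x "x + h"] lipschitz_from_derivative[of UNIV \<beta> \<beta>' \<Lambda> x "x + h"]
      lipschitz_from_derivative[of UNIV f f' \<Lambda> x "x + h"] \<alpha> \<beta> f by auto
  have half_sum_le: "\<bar>p / 2 + q / 2 + r\<bar> \<le> d + \<bar>r\<bar>" if "\<bar>p\<bar> \<le> d" "\<bar>q\<bar> \<le> d" for p q r d :: real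
    using that by linarith
  \<comment> \<open>Lipschitz bounds must precede the comparison with \<open>v\<close>: the Taylor
    remainders of \<open>a\<close> and \<open>b\<close> are small relative to the increments of
    \<open>w\<close> and \<open>U w\<close>, and these bounds make them small relative to
    \<open>h\<close>.\<close>
  have w_lip: "\<bar>w (x + h) t - w x t\<bar> \<le> K1 * \<bar>h\<bar>" if t: "t \<in> {0..T}" for x h t
  proof -
    have "\<bar>w (x + h) t - w x t\<bar> \<le> 2 * (\<Lambda> * \<bar>h\<bar> + L * (\<Lambda> * \<bar>h\<bar>)) * exp ((4 * L + 1) * T)"
    proof (rule wave_gronwall[OF continuous_on_strip_diff[OF continuous_on_strip_shift[OF cF] cF]
          continuous_on_strip_diff[OF continuous_on_strip_shift[OF w(1)] w(1)] L0 _ _ _ _ t])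
      fix x t assume t: "t \<in> {0..T}"
      show "\<bar>w (x + h) t - w x t\<bar> \<le> 2 * M"
        using w(2)[OF t, of x] w(2)[OF t, of "x + h"] by linarith
      have "wave F (x + h) t - wave F x t = wave (\<lambda>x t. F (x + h) t - F x t) x t"
        unfolding wave_shift using wave_diff[OF continuous_on_strip_shift[OF cF] cF] t by simp
      then have "w (x + h) t - w x t = (\<alpha> (x + t + h) - \<alpha> (x + t)) / 2 + (\<beta> (x - t + h) - \<beta> (x - t)) / 2
          + wave (\<lambda>x t. F (x + h) t - F x t) x t"
        using eq[OF t, of x] eq[OF t, of "x + h"] unfolding F_def by (simp add: field_simps)
      then show "\<bar>w (x + h) t - w x t\<bar> \<le> \<Lambda> * \<bar>h\<bar> + \<bar>wave (\<lambda>x t. F (x + h) t - F x t) x t\<bar>"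
        using half_sum_le[OF lip\<Lambda>(1)[of "x + t" h] lip\<Lambda>(2)[of "x - t" h]] by simp
      have "\<bar>a (w (x + h) t) - a (w x t)\<bar> \<le> L * \<bar>w (x + h) t - w x t\<bar>"
        by (rule lipschitz_from_derivative[where S = "{-K..K}", OF _ a(1) L(1)]) (use w_mem[OF t] in auto)
      moreover have "\<bar>b (U w (x + h) t) - b (U w x t)\<bar> \<le> L * \<bar>U w (x + h) t - U w x t\<bar>"
        by (rule lipschitz_from_derivative[where S = "{-K..K}", OF _ b(1) L(2)]) (use w_mem[OF t] in auto)
      moreover have "\<bar>U w (x + h) t - U w x t\<bar> \<le> \<Lambda> * \<bar>h\<bar> + \<bar>ray 0 (\<lambda>x t. w (x + h) t - w x t) x t\<bar>"
        using lip\<Lambda>(3)[of x h] ray_w_diff[OF t, of x h] unfolding U_def by linarith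
      then have "L * \<bar>U w (x + h) t - U w x t\<bar> \<le> L * (\<Lambda> * \<bar>h\<bar> + \<bar>ray 0 (\<lambda>x t. w (x + h) t - w x t) x t\<bar>)"
        using L0 by (rule mult_left_mono)
      ultimately show "\<bar>F (x + h) t - F x t\<bar> \<le> L * (\<bar>w (x + h) t - w x t\<bar> + \<bar>ray 0 (\<lambda>x t. w (x + h) t - w x t) x t\<bar>) + L * (\<Lambda> * \<bar>h\<bar>)"
        unfolding F_def by (simp add: algebra_simps) linarith
    qed (use L0 M0 in simp)
    then show ?thesis by (simp add: K1_def E_def algebra_simps)
  qed
  have U_lip: "\<bar>U w (x + h) t - U w x t\<bar> \<le> K2 * \<bar>h\<bar>" if t: "t \<in> {0..T}" for x h t
  proof -
    have "\<bar>ray 0 (\<lambda>x t. w (x + h) t - w x t) x t\<bar> \<le> T * (K1 * \<bar>h\<bar>)"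
      by (rule abs_ray_le_strip_const[OF continuous_on_strip_diff[OF continuous_on_strip_shift[OF w(1)] w(1)] t w_lip])
    moreover have "K2 * \<bar>h\<bar> = \<Lambda> * \<bar>h\<bar> + T * (K1 * \<bar>h\<bar>)" by (simp add: K2_def algebra_simps)
    ultimately show ?thesis
      using lip\<Lambda>(3)[of x h] ray_w_diff[OF t, of x h] unfolding U_def by linarith
  qed
  have K12: "K1 \<ge> 0" "K2 \<ge> 0" using M0 L0 E0 T by (auto simp: K1_def K2_def)
  have deriv: "((\<lambda>y. w y t) has_real_derivative v x t) (at x)" if t: "t \<in> {0..T}" for x t
  proof -
    \<comment> \<open>In the Gronwall estimate for the quotients, \<open>1\<close> comes from the
      remainders of \<open>\<alpha>\<close> and \<open>\<beta>\<close>, \<open>K1\<close> and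
      \<open>K2\<close> from those of \<open>a\<close> and \<open>b\<close>, and \<open>L\<close>
      from that of \<open>f\<close> multiplied by \<open>b'\<close>.\<close>
    define C where "C = 2 * (1 + (K1 + K2 + L)) * E"
    have C0: "C \<ge> 0" using K12 L0 E0 by (simp add: C_def)
    have "\<exists>\<delta>>0. \<forall>h. h \<noteq> 0 \<and> \<bar>h\<bar> < \<delta> \<longrightarrow> \<bar>(w (x + h) t - w x t) / h - v x t\<bar> \<le> C * \<eta>" if \<eta>: "\<eta> > 0" for \<eta>
    proof -
      obtain \<delta>1 where \<delta>1: "\<delta>1 > 0" "\<And>x h. \<bar>h\<bar> < \<delta>1 \<Longrightarrow> \<bar>\<alpha> (x + h) - \<alpha> x - \<alpha>' x * h\<bar> \<le> \<eta> * \<bar>h\<bar>"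
        using uniform_first_order_expansion[OF convex_UNIV \<alpha>(1,2) \<eta>] by (metis UNIV_I add_diff_cancel_left')
      obtain \<delta>2 where \<delta>2: "\<delta>2 > 0" "\<And>x h. \<bar>h\<bar> < \<delta>2 \<Longrightarrow> \<bar>\<beta> (x + h) - \<beta> x - \<beta>' x * h\<bar> \<le> \<eta> * \<bar>h\<bar>"
        using uniform_first_order_expansion[OF convex_UNIV \<beta>(1,2) \<eta>] by (metis UNIV_I add_diff_cancel_left')
      obtain \<delta>3 where \<delta>3: "\<delta>3 > 0" "\<And>x h. \<bar>h\<bar> < \<delta>3 \<Longrightarrow> \<bar>f (x + h) - f x - f' x * h\<bar> \<le> \<eta> * \<bar>h\<bar>"
        using uniform_first_order_expansion[OF convex_UNIV f(1,2) \<eta>] by (metis UNIV_I add_diff_cancel_left')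
      obtain \<delta>4 where \<delta>4: "\<delta>4 > 0" "\<And>y z. y \<in> {-K..K} \<Longrightarrow> z \<in> {-K..K} \<Longrightarrow> \<bar>z - y\<bar> < \<delta>4 \<Longrightarrow>
          \<bar>a z - a y - a' y * (z - y)\<bar> \<le> \<eta> * \<bar>z - y\<bar>"
        using uniform_first_order_expansion[OF _ a(1) ucab(1) \<eta>] by (metis convex_real_interval(5))
      obtain \<delta>5 where \<delta>5: "\<delta>5 > 0" "\<And>y z. y \<in> {-K..K} \<Longrightarrow> z \<in> {-K..K} \<Longrightarrow> \<bar>z - y\<bar> < \<delta>5 \<Longrightarrow>
          \<bar>b z - b y - b' y * (z - y)\<bar> \<le> \<eta> * \<bar>z - y\<bar>"
        using uniform_first_order_expansion[OF _ b(1) ucab(2) \<eta>] by (metis convex_real_interval(5))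
      \<comment> \<open>The last two terms force the increments of \<open>w\<close> and
        \<open>U w\<close> below \<open>\<delta>4\<close> and \<open>\<delta>5\<close>; adding 1
        keeps the denominators positive.\<close>
      define \<delta> where "\<delta> = min (min \<delta>1 (min \<delta>2 \<delta>3)) (min (\<delta>4 / (K1 + 1)) (\<delta>5 / (K2 + 1)))"
      have "\<delta> > 0" using \<delta>1 \<delta>2 \<delta>3 \<delta>4 \<delta>5 K12 by (simp add: \<delta>_def)
      moreover have "\<bar>(w (x + h) t - w x t) / h - v x t\<bar> \<le> C * \<eta>" if h: "h \<noteq> 0" "\<bar>h\<bar> < \<delta>" for h
      proof -
        have small: "K1 * \<bar>h\<bar> < \<delta>4" "K2 * \<bar>h\<bar> < \<delta>5"
        proof -
          have "\<bar>h\<bar> * (K1 + 1) < \<delta>4" "\<bar>h\<bar> * (K2 + 1) < \<delta>5"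
            using h(2) K12 by (simp_all add: \<delta>_def pos_less_divide_eq)
          then show "K1 * \<bar>h\<bar> < \<delta>4" "K2 * \<bar>h\<bar> < \<delta>5" by (simp_all add: algebra_simps)
        qed
        \<comment> \<open>\<open>e\<close> is the error of the difference quotient and
          \<open>k\<close> the error of the corresponding source. Both are spelled as linear
          combinations so that linearity of \<open>ray\<close> and \<open>wave\<close> applies
          literally.\<close>
        define e where "e = (\<lambda>x t. 1 / h * (w (x + h) t - w x t) + (- 1) * v x t)"
        define k where "k = (\<lambda>x t. 1 / h * (F (x + h) t - F x t) + (- 1) * N v x t)"
        note cw = continuous_on_strip_diff[OF continuous_on_strip_shift[OF w(1), of h] w(1)]
        note cFd = continuous_on_strip_diff[OF continuous_on_strip_shift[OF cF, of h] cF]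
        have ce: "continuous_on (strip T) (\<lambda>(x, t). e x t)"
          unfolding e_def by (rule continuous_on_strip_linear[OF cw v])
        have ck: "continuous_on (strip T) (\<lambda>(x, t). k x t)"
          unfolding k_def by (rule continuous_on_strip_linear[OF cFd cN[OF v]])
        have quot: "\<bar>(p - q) / h - d\<bar> \<le> r" if "\<bar>p - q - d * h\<bar> \<le> r * \<bar>h\<bar>" for p q d r :: real
        proof -
          have "\<bar>(p - q) / h - d\<bar> = \<bar>p - q - d * h\<bar> / \<bar>h\<bar>"
            using h(1) by (simp add: abs_divide[symmetric] diff_divide_distrib)
          then show ?thesis using that h(1) by (simp add: pos_divide_le_eq)
        qed
        have "\<bar>e x t\<bar> \<le> 2 * (\<eta> + (K1 + K2 + L) * \<eta>) * exp ((4 * L + 1) * T)"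
        proof (rule wave_gronwall[OF ck ce L0 _ _ _ _ t])
          fix x t assume t: "t \<in> {0..T}"
          then have tT: "t \<le> T" by simp
          have "\<bar>1 / h * (w (x + h) t - w x t)\<bar> \<le> K1"
            using w_lip[OF t, of x h] h(1) by (simp add: abs_mult pos_divide_le_eq)
          then show "\<bar>e x t\<bar> \<le> K1 + V" using V[OF t, of x] unfolding e_def by linarith
          have "wave k x t = 1 / h * (wave F (x + h) t - wave F x t) + (- 1) * wave (N v) x t"
            by (simp only: k_def wave_shift wave_linear[OF cFd cN[OF v] tT]
                wave_diff[OF continuous_on_strip_shift[OF cF] cF tT])
          moreover have W: "w (x + h) t - w x t = (\<alpha> (x + t + h) - \<alpha> (x + t)) / 2
              + (\<beta> (x - t + h) - \<beta> (x - t)) / 2 + (wave F (x + h) t - wave F x t)"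
            using eq[OF t, of x] eq[OF t, of "x + h"] unfolding F_def[symmetric] by (simp add: field_simps)
          ultimately have "e x t = ((\<alpha> (x + t + h) - \<alpha> (x + t)) / h - \<alpha>' (x + t)) / 2
              + ((\<beta> (x - t + h) - \<beta> (x - t)) / h - \<beta>' (x - t)) / 2 + wave k x t"
            unfolding e_def W veq[OF t, of x] \<phi>_def
            by (simp add: add_divide_distrib diff_divide_distrib algebra_simps)
          moreover have "\<bar>(\<alpha> (x + t + h) - \<alpha> (x + t)) / h - \<alpha>' (x + t)\<bar> \<le> \<eta>"
            "\<bar>(\<beta> (x - t + h) - \<beta> (x - t)) / h - \<beta>' (x - t)\<bar> \<le> \<eta>"
            using \<delta>1(2)[of h "x + t"] \<delta>2(2)[of h "x - t"] h(2) by (auto intro!: quot simp: \<delta>_def)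
          ultimately show "\<bar>e x t\<bar> \<le> \<eta> + \<bar>wave k x t\<bar>" using half_sum_le by metis
          have "\<bar>a (w (x + h) t) - a (w x t) - a' (w x t) * (w (x + h) t - w x t)\<bar> \<le> \<eta> * \<bar>w (x + h) t - w x t\<bar>"
            using w_lip[OF t, of x h] small by (intro \<delta>4(2) w_mem[OF t]) linarith
          also have "\<dots> \<le> \<eta> * (K1 * \<bar>h\<bar>)" using w_lip[OF t, of x h] \<eta> by simp
          finally have A: "\<bar>(a (w (x + h) t) - a (w x t)) / h - a' (w x t) * ((w (x + h) t - w x t) / h)\<bar> \<le> \<eta> * K1"
            using h(1) by (intro quot) (simp add: ac_simps)
          have "\<bar>b (U w (x + h) t) - b (U w x t) - b' (U w x t) * (U w (x + h) t - U w x t)\<bar> \<le> \<eta> * \<bar>U w (x + h) t - U w x t\<bar>"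
            using U_lip[OF t, of x h] small by (intro \<delta>5(2) w_mem[OF t]) linarith
          also have "\<dots> \<le> \<eta> * (K2 * \<bar>h\<bar>)" using U_lip[OF t, of x h] \<eta> by simp
          finally have B: "\<bar>(b (U w (x + h) t) - b (U w x t)) / h - b' (U w x t) * ((U w (x + h) t - U w x t) / h)\<bar> \<le> \<eta> * K2"
            using h(1) by (intro quot) (simp add: ac_simps)
          have "ray 0 e x t = 1 / h * (ray 0 w (x + h) t - ray 0 w x t) + (- 1) * ray 0 v x t"
            by (simp only: e_def ray_linear[OF cw v tT] ray_w_diff[OF t])
          then have "(U w (x + h) t - U w x t) / h - (f' x + ray 0 v x t) = ((f (x + h) - f x) / h - f' x) + ray 0 e x t"
            unfolding U_def by (simp add: diff_divide_distrib add_divide_distrib)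
          moreover have "\<bar>(f (x + h) - f x) / h - f' x\<bar> \<le> \<eta>"
            using \<delta>3(2)[of h x] h(2) by (auto intro!: quot simp: \<delta>_def)
          ultimately have "\<bar>(U w (x + h) t - U w x t) / h - (f' x + ray 0 v x t)\<bar> \<le> \<eta> + \<bar>ray 0 e x t\<bar>"
            by linarith
          then have B': "\<bar>b' (U w x t) * ((U w (x + h) t - U w x t) / h - (f' x + ray 0 v x t))\<bar> \<le> L * (\<eta> + \<bar>ray 0 e x t\<bar>)"
            unfolding abs_mult using L(2)[OF w_mem(2)[OF t, of x]] L0 by (intro mult_mono) auto
          have A': "\<bar>a' (w x t) * e x t\<bar> \<le> L * \<bar>e x t\<bar>"
            unfolding abs_mult using L(1)[OF w_mem(1)[OF t, of x]] by (intro mult_right_mono) auto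
          \<comment> \<open>Two Taylor remainders, bounded by \<open>A\<close> and \<open>B\<close>,
            plus two terms linear in the error, bounded by \<open>A'\<close> and \<open>B'\<close>;
            only the latter need Gronwall.\<close>
          have "k x t = ((a (w (x + h) t) - a (w x t)) / h - a' (w x t) * ((w (x + h) t - w x t) / h))
              + ((b (U w (x + h) t) - b (U w x t)) / h - b' (U w x t) * ((U w (x + h) t - U w x t) / h))
              + a' (w x t) * e x t + b' (U w x t) * ((U w (x + h) t - U w x t) / h - (f' x + ray 0 v x t))"
            unfolding k_def F_def N_def e_def by (simp add: algebra_simps diff_divide_distrib add_divide_distrib)
          then have "\<bar>k x t\<bar> \<le> \<eta> * K1 + \<eta> * K2 + L * \<bar>e x t\<bar> + L * (\<eta> + \<bar>ray 0 e x t\<bar>)"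
            using A A' B B' by linarith
          then show "\<bar>k x t\<bar> \<le> L * (\<bar>e x t\<bar> + \<bar>ray 0 e x t\<bar>) + (K1 + K2 + L) * \<eta>"
            by (simp add: algebra_simps)
        qed (use L0 K12 \<eta> in simp)
        moreover have "e x t = (w (x + h) t - w x t) / h - v x t" by (simp add: e_def)
        moreover have "2 * (\<eta> + (K1 + K2 + L) * \<eta>) * exp ((4 * L + 1) * T) = C * \<eta>"
          by (simp add: C_def E_def algebra_simps)
        ultimately show ?thesis by simp
      qed
      ultimately show ?thesis by blast
    qed
    note * = this
    show ?thesis
      unfolding DERIV_def LIM_eq
    proof (intro allI impI)
      fix r :: real assume "r > 0"
      then have "r / (C + 1) > 0" using C0 by simp
      from *[OF this] obtain \<delta> where \<delta>: "\<delta> > 0"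
        "\<And>h. h \<noteq> 0 \<Longrightarrow> \<bar>h\<bar> < \<delta> \<Longrightarrow> \<bar>(w (x + h) t - w x t) / h - v x t\<bar> \<le> C * (r / (C + 1))" by blast
      have "C * (r / (C + 1)) < r" using C0 \<open>r > 0\<close> by (simp add: divide_simps)
      with \<delta> show "\<exists>s>0. \<forall>h. h \<noteq> 0 \<and> norm (h - 0) < s \<longrightarrow> norm ((w (x + h) t - w x t) / h - v x t) < r"
        by (metis diff_zero order_le_less_trans real_norm_def)
    qed
  qed
  show thesis
    by (rule that[OF v deriv]) (use veq in \<open>auto simp: \<phi>_def N_def\<close>)
qed

subsection \<open>From the integral equation to classical solutions\<close>

lemma D_x_eq: "((\<lambda>y. u y t) has_real_derivative d) (at x) \<Longrightarrow> D_x u x t = d"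
  by (simp add: D_x_def DERIV_imp_deriv)

text \<open>With \<open>T > 0\<close> the interval is nondegenerate, so derivatives within it are
  unique, also at its endpoints.\<close>

lemma D_t_eq:
  "\<lbrakk>T > 0; t \<in> {0..T}; ((\<lambda>s. u x s) has_vector_derivative d) (at t within {0..T})\<rbrakk> \<Longrightarrow> D_t T u x t = d"
  unfolding D_t_def by (rule vector_derivative_within_closed_interval)

text \<open>The class sees only the strip: time derivatives are taken within the interval, and space
  derivatives on whole horizontal lines. Hence \<open>D_x\<close> and \<open>D_t\<close> may be
  replaced by explicit formulas valid on the strip alone.\<close>

lemma C_k_strip_cong:
  assumes "\<And>x t. t \<in> {0..T} \<Longrightarrow> u x t = u' x t" "C_k_strip k T u"
  shows "C_k_strip k T u'"
  using assms
proof (induction k arbitrary: u u')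
  case 0
  then show ?case by (auto simp: strip_def elim!: continuous_on_eq)
next
  case (Suc k)
  have x: "(\<lambda>y. u' y t) = (\<lambda>y. u y t)" if "t \<in> {0..T}" for t
    using Suc.prems(1)[OF that] by (simp add: fun_eq_iff)
  have t: "(\<lambda>s. u' x s) differentiable (at t within {0..T})"
    if "(\<lambda>s. u x s) differentiable (at t within {0..T})" "t \<in> {0..T}" for x t
    using that Suc.prems(1) by (metis differentiable_transform_within zero_less_one)
  have "D_t T u x t = D_t T u' x t" if "t \<in> {0..T}" for x t
    unfolding D_t_def
    by (rule vector_derivative_cong_eq) (use Suc.prems(1) that in \<open>auto simp: eventually_at_filter\<close>)
  moreover have "D_x u x t = D_x u' x t" if "t \<in> {0..T}" for x t
    using x[OF that] by (simp add: D_x_def)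
  moreover have "continuous_on (strip T) (\<lambda>(x, t). u' x t)"
    using Suc.prems by (auto simp: strip_def elim!: continuous_on_eq)
  ultimately show ?case
    using Suc.prems(2) x t Suc.IH[of "D_x u" "D_x u'"] Suc.IH[of "D_t T u" "D_t T u'"] by auto
qed

lemma C_k_strip_SucI:
  assumes T: "T > 0" and u: "continuous_on (strip T) (\<lambda>(x, t). u x t)"
    and x: "\<And>x t. t \<in> {0..T} \<Longrightarrow> ((\<lambda>y. u y t) has_real_derivative ux x t) (at x)"
    and t: "\<And>x t. t \<in> {0..T} \<Longrightarrow> ((\<lambda>s. u x s) has_vector_derivative ut x t) (at t within {0..T})"
    and "C_k_strip k T ux" "C_k_strip k T ut"
  shows "C_k_strip (Suc k) T u"
proof -
  have "C_k_strip k T (D_x u)"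
    by (rule C_k_strip_cong[OF _ assms(5)]) (use D_x_eq x in metis)
  moreover have "C_k_strip k T (D_t T u)"
    by (rule C_k_strip_cong[OF _ assms(6)]) (use D_t_eq[OF T] t in metis)
  moreover have xd: "(\<lambda>y. u y t) differentiable (at x)" if "t \<in> {0..T}" for x t
    using x[OF that] unfolding real_differentiable_def by blast
  ultimately show ?thesis
    using u differentiableI_vector[OF t] xd by auto
qed

text \<open>The equation splits into two transport equations for the Riemann invariants
  \<open>u_t + u_x\<close> and \<open>u_t - u_x\<close>. Their first derivatives supply every second
  derivative of \<open>u\<close>, so no second derivative of \<open>a\<close> or \<open>b\<close> is
  required.\<close>

lemma wave_solution_classical:
  fixes w :: "real \<Rightarrow> real \<Rightarrow> real" and f g a b f' f'' g' a' b' :: "real \<Rightarrow> real"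
  defines "u \<equiv> \<lambda>x t. f x + ray 0 w x t"
  assumes T: "T > 0"
    and w: "continuous_on (strip T) (\<lambda>(x, t). w x t)" "\<And>x t. t \<in> {0..T} \<Longrightarrow> \<bar>w x t\<bar> \<le> M"
    and f: "\<And>x. (f has_real_derivative f' x) (at x)" "\<And>x. (f' has_real_derivative f'' x) (at x)"
      "uniformly_continuous_on UNIV f'" "uniformly_continuous_on UNIV f''" 
    and g: "\<And>x. (g has_real_derivative g' x) (at x)" "uniformly_continuous_on UNIV g'"
    and bdd: "\<And>x. \<bar>f x\<bar> \<le> M" "\<And>x. \<bar>f' x\<bar> \<le> \<Lambda>" "\<And>x. \<bar>f'' x\<bar> \<le> \<Lambda>" "\<And>x. \<bar>g' x\<bar> \<le> \<Lambda>"
    and a: "\<And>x. (a has_real_derivative a' x) (at x)" "continuous_on UNIV a'"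
    and b: "\<And>x. (b has_real_derivative b' x) (at x)" "continuous_on UNIV b'"
    and eq: "\<And>x t. t \<in> {0..T} \<Longrightarrow>
      w x t = ((g (x + t) + f' (x + t)) + (g (x - t) - f' (x - t))) / 2 + wave (\<lambda>x t. a (w x t) + b (u x t)) x t"
  shows "C_k_strip 2 T u" "\<And>x. u x 0 = f x" "\<And>x t. t \<in> {0..T} \<Longrightarrow> D_t T u x t = w x t" "\<And>x. w x 0 = g x"
    "\<And>x t. t \<in> {0..T} \<Longrightarrow> D_t T (D_t T u) x t - D_x (D_x u) x t = a (w x t) + b (u x t)"
proof -
  define \<alpha> where "\<alpha> \<sigma> x = g x + \<sigma> * f' x" for \<sigma> x
  define \<alpha>' where "\<alpha>' \<sigma> x = g' x + \<sigma> * f'' x" for \<sigma> x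
  have \<alpha>: "(\<alpha> \<sigma> has_real_derivative \<alpha>' \<sigma> x) (at x)" for \<sigma> x
    unfolding \<alpha>_def \<alpha>'_def using f g by (auto intro!: derivative_eq_intros)
  have uc: "uniformly_continuous_on UNIV (\<alpha>' \<sigma>)" for \<sigma>
    unfolding \<alpha>'_def using f g by (intro uniformly_continuous_on_add bounded_linear.uniformly_continuous_on[OF bounded_linear_mult_right])
  have bd: "\<bar>\<alpha>' \<sigma> x\<bar> \<le> 2 * \<Lambda>" if "\<bar>\<sigma>\<bar> = 1" for \<sigma> x
    using bdd(3)[of x] bdd(4)[of x] that abs_triangle_ineq[of "g' x" "\<sigma> * f'' x"] by (simp add: \<alpha>'_def abs_mult)
  have f'2: "\<bar>f' x\<bar> \<le> 2 * \<Lambda>" for x using bdd(2)[of x] by linarith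
  have eq': "w x t = (\<alpha> 1 (x + t) + \<alpha> (- 1) (x - t)) / 2 + wave (\<lambda>x t. a (w x t) + b (f x + ray 0 w x t)) x t"
    if "t \<in> {0..T}" for x t
    using eq[OF that, of x] by (simp add: \<alpha>_def u_def)
  obtain v where v: "continuous_on (strip T) (\<lambda>(x, t). v x t)"
    and wx: "\<And>x t. t \<in> {0..T} \<Longrightarrow> ((\<lambda>y. w y t) has_real_derivative v x t) (at x)"
    and veq: "\<And>x t. t \<in> {0..T} \<Longrightarrow> v x t = (\<alpha>' 1 (x + t) + \<alpha>' (- 1) (x - t)) / 2
           + wave (\<lambda>x t. a' (w x t) * v x t + b' (f x + ray 0 w x t) * (f' x + ray 0 v x t)) x t"
    by (rule wave_solution_space_derivative[where \<alpha>="\<alpha> 1" and \<alpha>'="\<alpha>' 1" and \<beta>="\<alpha> (- 1)" and \<beta>'="\<alpha>' (- 1)" and \<Lambda>="2*\<Lambda>"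
          and M=M and w=w and a=a and b=b and a'=a' and b'=b' and f=f and f'=f' and T=T])
       (use w \<alpha> uc bd f(1,3) f'2 bdd(1) a b T eq' in auto)
  define F where "F = (\<lambda>x t. a (w x t) + b (u x t))"
  define F' where "F' = (\<lambda>x t. a' (w x t) * v x t + b' (u x t) * (f' x + ray 0 v x t))"
  have cont: "continuous_on UNIV f" "continuous_on UNIV f'" "continuous_on UNIV a" "continuous_on UNIV b"
    "continuous_on UNIV (\<alpha> \<sigma>)" "continuous_on UNIV (\<alpha>' \<sigma>)" for \<sigma>
    by (rule DERIV_continuous_on[OF f(1)] DERIV_continuous_on[OF f(2)] DERIV_continuous_on[OF a(1)]
          DERIV_continuous_on[OF b(1)] DERIV_continuous_on[OF \<alpha>] uniformly_continuous_imp_continuous[OF uc])+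
  have cu: "continuous_on (strip T) (\<lambda>(x, t). u x t)"
    using continuous_on_ray[OF w(1), of 0] unfolding u_def split_beta
    by (intro continuous_intros continuous_on_compose2[OF cont(1)]) auto
  have cF: "continuous_on (strip T) (\<lambda>(x, t). F x t)"
    using w(1) cu unfolding F_def split_beta
    by (intro continuous_intros continuous_on_compose2[OF cont(3)] continuous_on_compose2[OF cont(4)]) auto
  have cF': "continuous_on (strip T) (\<lambda>(x, t). F' x t)"
    using w(1) cu v continuous_on_ray[OF v, of 0] unfolding F'_def split_beta
    by (intro continuous_intros continuous_on_compose2[OF a(2)] continuous_on_compose2[OF b(2)]
        continuous_on_compose2[OF cont(2)]) auto
  have ux0: "((\<lambda>y. u y t) has_real_derivative f' x + ray 0 v x t) (at x)" if "t \<in> {0..T}" for x t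
    unfolding u_def using ray_has_derivative_space[OF w(1) v _ wx, of t 0 x] that f(1)
    by (auto intro!: derivative_eq_intros)
  have Fx: "((\<lambda>y. F y t) has_real_derivative F' x t) (at x)" if "t \<in> {0..T}" for x t
    unfolding F_def F'_def
    by (rule derivative_eq_intros DERIV_chain2[OF a(1) wx] DERIV_chain2[OF b(1) ux0] refl that)+
  \<comment> \<open>\<open>P 1\<close> and \<open>P (- 1)\<close> are the Riemann invariants, with
    initial values \<open>g + f'\<close> and \<open>g - f'\<close>; both have source
    \<open>F\<close>. Their half sum is \<open>w\<close>, and their half difference \<open>z\<close>
    turns out to be \<open>u_x\<close>.\<close>
  define P where "P \<sigma> x t = \<alpha> \<sigma> (x + \<sigma> * t) + ray \<sigma> F x t" for \<sigma> x t
  define P' where "P' \<sigma> x t = \<alpha>' \<sigma> (x + \<sigma> * t) + ray \<sigma> F' x t" for \<sigma> x t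
  have Px: "((\<lambda>y. P \<sigma> y t) has_real_derivative P' \<sigma> x t) (at x)" if "t \<in> {0..T}" for \<sigma> x t
    unfolding P_def P'_def
    using ray_has_derivative_space[OF cF cF' _ Fx, of t \<sigma> x] that \<alpha>[of \<sigma> "x + \<sigma> * t"]
    by (intro DERIV_add) (auto simp: DERIV_shift)
  have Pt: "((\<lambda>s. P \<sigma> x s) has_vector_derivative \<sigma> * P' \<sigma> x t + F x t) (at t within {0..T})" if "t \<in> {0..T}" for \<sigma> x t
  proof -
    have "((\<lambda>s. \<alpha> \<sigma> (x + \<sigma> * s)) has_real_derivative \<alpha>' \<sigma> (x + \<sigma> * t) * \<sigma>) (at t within {0..T})"
      by (rule DERIV_chain2[OF \<alpha>]) (auto intro!: derivative_eq_intros)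
    from has_vector_derivative_add[OF this[unfolded has_real_derivative_iff_has_vector_derivative]
        ray_has_derivative_time[OF cF cF' that Fx]]
    show ?thesis unfolding P_def P'_def by (simp add: algebra_simps)
  qed
  have cP: "continuous_on (strip T) (\<lambda>(x, t). P \<sigma> x t)" for \<sigma>
    using continuous_on_ray[OF cF, of \<sigma>] unfolding P_def split_beta
    by (intro continuous_intros continuous_on_compose2[OF cont(5)]) auto
  have cP': "continuous_on (strip T) (\<lambda>(x, t). P' \<sigma> x t)" for \<sigma>
    using continuous_on_ray[OF cF', of \<sigma>] unfolding P'_def split_beta
    by (intro continuous_intros continuous_on_compose2[OF cont(6)]) auto
  have weq: "w x t = (P 1 x t + P (- 1) x t) / 2" if "t \<in> {0..T}" for x t
    using eq'[OF that, of x] unfolding P_def wave_def F_def u_def by (simp add: field_simps)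
  have veq': "v x t = (P' 1 x t + P' (- 1) x t) / 2" if "t \<in> {0..T}" for x t
    using veq[OF that, of x] unfolding P'_def wave_def F'_def u_def by (simp add: field_simps)
  define z where "z x t = (P 1 x t - P (- 1) x t) / 2" for x t
  define zx where "zx x t = (P' 1 x t - P' (- 1) x t) / 2" for x t
  have z_t: "((\<lambda>s. z x s) has_vector_derivative v x t) (at t within {0..T})" if "t \<in> {0..T}" for x t
    unfolding z_def veq'[OF that]
    using Pt[OF that, of 1 x] Pt[OF that, of "-1" x]
    by (auto intro!: derivative_eq_intros simp: has_real_derivative_iff_has_vector_derivative[symmetric])
  have z_x: "((\<lambda>y. z y t) has_real_derivative zx x t) (at x)" if "t \<in> {0..T}" for x t
    unfolding z_def zx_def using Px[OF that, of 1 x] Px[OF that, of "-1" x] by (auto intro!: derivative_eq_intros)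
  have w_t: "((\<lambda>s. w x s) has_vector_derivative zx x t + F x t) (at t within {0..T})" if "t \<in> {0..T}" for x t
  proof -
    have "((\<lambda>s. (P 1 x s + P (- 1) x s) / 2) has_vector_derivative zx x t + F x t) (at t within {0..T})"
      unfolding zx_def using Pt[OF that, of 1 x] Pt[OF that, of "-1" x]
      by (auto intro!: derivative_eq_intros simp: has_real_derivative_iff_has_vector_derivative[symmetric] field_simps)
    then show ?thesis
      by (rule has_vector_derivative_transform[OF that weq, rotated])
  qed
  have cz: "continuous_on (strip T) (\<lambda>(x, t). z x t)" "continuous_on (strip T) (\<lambda>(x, t). zx x t)"
    using cP[of 1] cP[of "-1"] cP'[of 1] cP'[of "-1"] unfolding z_def zx_def split_beta
    by (auto intro!: continuous_intros)
  have cwt: "continuous_on (strip T) (\<lambda>(x, t). zx x t + F x t)"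
    using cz(2) cF unfolding split_beta by (intro continuous_intros)
  \<comment> \<open>Differentiating \<open>u\<close> under the integral gives \<open>f'\<close> plus
    the time integral of \<open>v\<close>. Since \<open>z\<close> has time derivative
    \<open>v\<close> and initial value \<open>f'\<close>, this is \<open>z\<close>.\<close>
  have u_x: "((\<lambda>y. u y t) has_real_derivative z x t) (at x)" if t: "t \<in> {0..T}" for x t
  proof -
    have "(v x has_integral (z x t - z x 0)) {0..t}"
      by (rule fundamental_theorem_of_calculus)
         (use t in \<open>auto intro!: has_vector_derivative_within_subset[OF z_t]\<close>)
    then have "ray 0 v x t = z x t - z x 0" by (simp add: ray_def integral_unique)
    moreover have "z x 0 = f' x" by (simp add: z_def P_def \<alpha>_def ray_def)
    ultimately show ?thesis using ux0[OF t, of x] by simp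
  qed
  have u_t: "((\<lambda>s. u x s) has_vector_derivative w x t) (at t within {0..T})" if t: "t \<in> {0..T}" for x t
    using has_vector_derivative_add[OF has_vector_derivative_const ray_has_derivative_time[OF w(1) v t wx], of "f x" 0]
    by (simp add: u_def)
  have "C_k_strip 1 T z"
    unfolding One_nat_def by (rule C_k_strip_SucI[OF T cz(1) z_x z_t]) (use cz v in auto)
  moreover have "C_k_strip 1 T w"
    unfolding One_nat_def by (rule C_k_strip_SucI[OF T w(1) wx w_t]) (use cwt v in auto)
  ultimately show "C_k_strip 2 T u"
    unfolding numeral_2_eq_2 One_nat_def by (intro C_k_strip_SucI[OF T cu u_x u_t])
  show "u x 0 = f x" for x by (simp add: u_def ray_def)
  show Dt: "D_t T u x t = w x t" if "t \<in> {0..T}" for x t by (rule D_t_eq[OF T that u_t[OF that]])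
  show "w x 0 = g x" for x using eq[of 0 x] T by (simp add: wave_def ray_def)
  show "D_t T (D_t T u) x t - D_x (D_x u) x t = a (w x t) + b (u x t)" if t: "t \<in> {0..T}" for x t
  proof -
    have "((\<lambda>s. D_t T u x s) has_vector_derivative zx x t + F x t) (at t within {0..T})"
      by (rule has_vector_derivative_transform[OF t _ w_t[OF t]]) (use Dt in auto)
    then have "D_t T (D_t T u) x t = zx x t + F x t" by (rule D_t_eq[OF T t])
    moreover have "D_x u y t = z y t" for y by (rule D_x_eq[where u=u, OF u_x[OF t]])
    then have "D_x (D_x u) x t = zx x t" using z_x[OF t, of x] by (intro D_x_eq) simp
    ultimately show ?thesis by (simp add: F_def)
  qed
qed

subsection \<open>Powers and compactly supported functions\<close>

lemma continuous_on_abs_powr: "r > 0 \<Longrightarrow> continuous_on UNIV (\<lambda>z::real. \<bar>z\<bar> powr r)"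
  by (intro continuous_on_powr' continuous_intros) auto

lemma abs_powr_tendsto_zero: "r > 0 \<Longrightarrow> ((\<lambda>z::real. \<bar>z\<bar> powr r) \<longlongrightarrow> 0) (at 0)"
  using continuous_on_abs_powr[of r] by (force simp: continuous_on_eq_continuous_at isCont_def dest!: spec[of _ 0])

text \<open>The origin is the critical point: the difference quotient there is bounded by
  \<open>\<bar>h\<bar> powr (p - 1)\<close>, which tends to 0 because \<open>p > 1\<close>.\<close>

lemma has_real_derivative_abs_powr:
  fixes z p :: real
  assumes "p > 1"
  shows "((\<lambda>z. \<bar>z\<bar> powr p) has_real_derivative p * sgn z * \<bar>z\<bar> powr (p - 1)) (at z)"
proof -
  consider "z > 0" | "z < 0" | "z = 0" by linarith
  then show ?thesis
  proof cases
    case 1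
    have "((\<lambda>z. z powr p) has_real_derivative p * sgn z * \<bar>z\<bar> powr (p - 1)) (at z)"
      using has_real_derivative_powr[OF 1, of p] 1 by simp
    then show ?thesis
      by (rule DERIV_cong_ev[THEN iffD1, OF refl _ refl, rotated])
         (use eventually_nhds_in_open[of "{0<..}" z] 1 in \<open>auto elim!: eventually_mono\<close>)
  next
    case 2
    have "((\<lambda>z. (- z) powr p) has_real_derivative (p * (- z) powr (p - 1)) * (- 1)) (at z)"
      by (rule DERIV_chain2[OF has_real_derivative_powr]) (use 2 in \<open>auto intro!: derivative_eq_intros\<close>)
    then have "((\<lambda>z. (- z) powr p) has_real_derivative p * sgn z * \<bar>z\<bar> powr (p - 1)) (at z)"
      using 2 by simp
    then show ?thesis
      by (rule DERIV_cong_ev[THEN iffD1, OF refl _ refl, rotated])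
         (use eventually_nhds_in_open[of "{..<0}" z] 2 in \<open>auto elim!: eventually_mono\<close>)
  next
    case 3
    have "((\<lambda>h::real. \<bar>h\<bar> powr p / h) \<longlongrightarrow> 0) (at 0)"
    proof (rule Lim_null_comparison)
      show "\<forall>\<^sub>F h in at 0. norm (\<bar>h\<bar> powr p / h) \<le> \<bar>h\<bar> powr (p - 1)"
        by (auto simp: eventually_at_filter powr_diff)
    qed (use abs_powr_tendsto_zero assms in auto)
    then show ?thesis using 3 by (simp add: DERIV_def)
  qed
qed

lemma continuous_on_sgn_abs_powr:
  fixes r :: real
  assumes "r > 0"
  shows "continuous_on UNIV (\<lambda>z. sgn z * \<bar>z\<bar> powr r)"
proof (rule continuous_at_imp_continuous_on, intro ballI)
  fix z :: real
  show "isCont (\<lambda>z. sgn z * \<bar>z\<bar> powr r) z"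
  proof (cases "z = 0")
    case True
    have "((\<lambda>z::real. sgn z * \<bar>z\<bar> powr r) \<longlongrightarrow> 0) (at 0)"
      by (rule Lim_null_comparison[OF _ abs_powr_tendsto_zero[OF assms]])
         (auto simp: abs_mult abs_sgn_eq)
    with True show ?thesis by (simp add: isCont_def)
  next
    case False
    moreover have "isCont (\<lambda>z. \<bar>z\<bar> powr r) z"
      using continuous_on_abs_powr[OF assms] by (simp add: continuous_on_eq_continuous_at)
    ultimately show ?thesis by (intro continuous_intros) auto
  qed
qed

section \<open>Functions of compact support\<close>

lemma uniformly_continuous_compact_support:
  fixes \<phi> :: "real \<Rightarrow> real"
  assumes "continuous_on UNIV \<phi>" "\<And>x. \<bar>x\<bar> > R \<Longrightarrow> \<phi> x = 0"
  shows "uniformly_continuous_on UNIV \<phi>"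
proof -
  define I where "I = {- (\<bar>R\<bar> + 1)..\<bar>R\<bar> + 1}"
  \<comment> \<open>Clamping to \<open>I\<close> does not increase distances, and it leaves
    \<open>\<phi>\<close> unchanged because the extra 1 puts the endpoints of \<open>I\<close> where
    \<open>\<phi>\<close> vanishes.\<close>
  define cl where "cl x = max (- (\<bar>R\<bar> + 1)) (min (\<bar>R\<bar> + 1) x)" for x
  have cl: "\<phi> x = \<phi> (cl x)" for x
    using assms(2)[of x] assms(2)[of "\<bar>R\<bar> + 1"] assms(2)[of "- (\<bar>R\<bar> + 1)"]
    by (cases "x \<in> I") (auto simp: I_def cl_def max_def min_def)
  have "uniformly_continuous_on I \<phi>"
    unfolding I_def using assms(1) by (auto intro!: compact_uniformly_continuous elim: continuous_on_subset)
  show ?thesis unfolding uniformly_continuous_on_def dist_real_def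
  proof (intro allI impI)
    fix e :: real assume "e > 0"
    then obtain d where d: "d > 0" "\<And>x y. x \<in> I \<Longrightarrow> y \<in> I \<Longrightarrow> \<bar>y - x\<bar> < d \<Longrightarrow> \<bar>\<phi> y - \<phi> x\<bar> < e"
      using \<open>uniformly_continuous_on I \<phi>\<close> unfolding uniformly_continuous_on_def dist_real_def by meson
    have "\<bar>\<phi> y - \<phi> x\<bar> < e" if "\<bar>y - x\<bar> < d" for x y
    proof -
      have "\<bar>cl y - cl x\<bar> < d" using that by (auto simp: cl_def max_def min_def)
      moreover have "cl x \<in> I" "cl y \<in> I" by (auto simp: I_def cl_def)
      ultimately have "\<bar>\<phi> (cl y) - \<phi> (cl x)\<bar> < e" using d(2) by blast
      then show ?thesis by (simp only: cl[symmetric])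
    qed
    with d(1) show "\<exists>d>0. \<forall>x\<in>UNIV. \<forall>x'\<in>UNIV. \<bar>x' - x\<bar> < d \<longrightarrow> \<bar>\<phi> x' - \<phi> x\<bar> < e" by blast
  qed
qed

lemma bounded_compact_support:
  fixes \<phi> :: "real \<Rightarrow> real"
  assumes "continuous_on UNIV \<phi>" "\<And>x. \<bar>x\<bar> > R \<Longrightarrow> \<phi> x = 0"
  obtains m where "\<And>x. \<bar>\<phi> x\<bar> \<le> m"
proof -
  obtain L where L: "\<And>x. x \<in> {-R..R} \<Longrightarrow> \<bar>\<phi> x\<bar> \<le> L" using continuous_bounded_Icc[OF assms(1)] by blast
  have "\<bar>\<phi> x\<bar> \<le> max L 0" for x
  proof (cases "\<bar>x\<bar> > R")
    case False
    then have "x \<in> {-R..R}" by auto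
    from L[OF this] show ?thesis by simp
  qed (simp add: assms(2))
  then show thesis by (rule that)
qed

lemma deriv_zero_outside:
  fixes \<phi> :: "real \<Rightarrow> real"
  assumes "\<And>x. \<bar>x\<bar> > R \<Longrightarrow> \<phi> x = 0" "\<bar>x\<bar> > R"
  shows "deriv \<phi> x = 0"
proof -
  have "open {x::real. \<bar>x\<bar> > R}" by (intro open_Collect_less continuous_intros)
  then have "\<forall>\<^sub>F y in nhds x. y \<in> {x. \<bar>x\<bar> > R}" using assms(2) by (intro eventually_nhds_in_open) auto
  then have "\<forall>\<^sub>F y in nhds x. \<phi> y = 0" by eventually_elim (use assms(1) in auto)
  then have "deriv \<phi> x = deriv (\<lambda>_. 0) x" by (intro deriv_cong_ev) auto
  then show ?thesis by simp
qed

lemma supp_zero_outside: "supp \<phi> \<subseteq> {x. \<bar>x\<bar> \<le> R} \<Longrightarrow> \<bar>x\<bar> > R \<Longrightarrow> \<phi> x = 0"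
  unfolding supp_def using closure_subset[of "{x. \<phi> x \<noteq> 0}"] by force

subsection \<open>A priori bounds and lifespan\<close>

text \<open>The two smallness conditions are dictated by the decay deep inside the cone. There the
  \<open>p\<close>-term costs \<open>R + 1\<close> times its maximal size, \<open>R\<close> for
  crossing the neighbourhood of the cone and 1 for the decayed remainder; the \<open>q\<close>-term
  costs the full time. Both must fit under \<epsilon> / (1 + T).\<close>

lemma wave_solution_exists:
  fixes \<alpha> \<beta> f :: "real \<Rightarrow> real"
  assumes pq: "p > 1" "q > 1" and AB: "A \<ge> 0" "B \<ge> 0" and R: "R \<ge> 0" and T: "T \<ge> 0" and \<epsilon>: "\<epsilon> > 0" 
    and cont: "continuous_on UNIV \<alpha>" "continuous_on UNIV \<beta>" "continuous_on UNIV f"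
    and zero: "\<And>x. \<bar>x\<bar> > R \<Longrightarrow> \<alpha> x = 0" "\<And>x. \<bar>x\<bar> > R \<Longrightarrow> \<beta> x = 0" "\<And>x. \<bar>x\<bar> > R \<Longrightarrow> f x = 0"
    and bdd: "\<And>x. \<bar>\<alpha> x\<bar> \<le> m * \<epsilon>" "\<And>x. \<bar>\<beta> x\<bar> \<le> m * \<epsilon>" "\<And>x. \<bar>f x\<bar> \<le> m * \<epsilon>"
    and small: "A * ((m + 1) * \<epsilon>) powr p * (R + 1) * (1 + T) \<le> \<epsilon> / 2"
      "B * ((m + (2 * R + 1) * (m + 1)) * \<epsilon>) powr q * (1 + T)\<^sup>2 \<le> \<epsilon> / 2"
  obtains w where "continuous_on (strip T) (\<lambda>(x, t). w x t)"
    and "\<And>x t. t \<in> {0..T} \<Longrightarrow> \<bar>w x t\<bar> \<le> (m + 1) * \<epsilon>"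
    and "\<And>x t. t \<in> {0..T} \<Longrightarrow> w x t = (\<alpha> (x + t) + \<beta> (x - t)) / 2
          + wave (\<lambda>x t. A * \<bar>w x t\<bar> powr p + B * \<bar>f x + ray 0 w x t\<bar> powr q) x t"
proof -
  define S where "S = 1 + T"
  \<comment> \<open>Of this bound for \<open>w\<close>, the free part takes
    \<open>m * \<epsilon>\<close>, which leaves \<open>\<epsilon>\<close> for the nonlinear
    part.\<close>
  define \<mu> where "\<mu> = (m + 1) * \<epsilon>"
  \<comment> \<open>The bound for \<open>u\<close>: the initial value gives
    \<open>m * \<epsilon>\<close>, a vertical line spends at most time \<open>2 * R\<close> near the
    cone where \<open>w\<close> is at most \<open>\<mu>\<close>, and the decayed part integrates to
    at most one further \<open>\<mu>\<close>.\<close>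
  define \<nu> where "\<nu> = (m + (2 * R + 1) * (m + 1)) * \<epsilon>"
  define a0 where "a0 = A * \<mu> powr p"
  define b0 where "b0 = B * \<nu> powr q"
  have S: "S \<ge> 1" "T \<le> S" using T by (auto simp: S_def)
  have m: "m \<ge> 0" using bdd(1)[of 0] \<epsilon> by (smt (verit) mult_neg_pos)
  have \<mu>0: "\<mu> \<ge> \<epsilon>" "\<mu> > 0" using m \<epsilon> by (auto simp: \<mu>_def mult_le_cancel_right1)
  have \<mu>S: "\<mu> / S \<le> \<mu>" "\<mu> / S > 0" using \<mu>0 S by (auto simp: pos_divide_le_eq mult_le_cancel_left1)
  have \<nu>: "m * \<epsilon> + (2 * R + 1) * \<mu> = \<nu>" by (simp add: \<mu>_def \<nu>_def algebra_simps)
  have "0 \<le> m * \<epsilon>" "0 \<le> R * \<mu>" using m \<epsilon> R \<mu>0 by auto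
  then have \<nu>0: "\<nu> \<ge> \<mu>" unfolding \<nu>[symmetric] by (simp add: algebra_simps)
  have ab0: "a0 \<ge> 0" "b0 \<ge> 0" using AB by (auto simp: a0_def b0_def)
  have "a0 * (R + 1) * S \<le> \<epsilon> / 2" "b0 * S * S \<le> \<epsilon> / 2"
    using small by (simp_all add: a0_def b0_def \<mu>_def \<nu>_def S_def power2_eq_square mult.assoc)
  then have "a0 * (R + 1) \<le> \<epsilon> / 2 / S" "b0 * S \<le> \<epsilon> / 2 / S"
    using S(1) by (simp_all only: pos_le_divide_eq[of S])
  then have small': "a0 * (R + 1) \<le> \<epsilon> / (2 * S)" "b0 * S \<le> \<epsilon> / (2 * S)" by simp_all
  define X where "X = {w :: real \<Rightarrow> real \<Rightarrow> real. continuous_on (strip T) (\<lambda>(x, t). w x t) \<and>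
    (\<forall>x. \<forall>t\<in>{0..T}. (\<bar>x\<bar> > t + R \<longrightarrow> w x t = 0) \<and> \<bar>w x t\<bar> \<le> \<mu> \<and> (\<bar>x\<bar> < t - R \<longrightarrow> \<bar>w x t\<bar> \<le> \<mu> / S))}"
  have XD: "continuous_on (strip T) (\<lambda>(x, t). w x t)" "\<And>x t. t \<in> {0..T} \<Longrightarrow> \<bar>w x t\<bar> \<le> \<mu>"
    "\<And>x t. t \<in> {0..T} \<Longrightarrow> \<bar>x\<bar> > t + R \<Longrightarrow> w x t = 0"
    "\<And>x t. t \<in> {0..T} \<Longrightarrow> \<bar>x\<bar> < t - R \<Longrightarrow> \<bar>w x t\<bar> \<le> \<mu> / S" if "w \<in> X" for w
    using that by (auto simp: X_def)
  define U where "U w x t = f x + ray 0 w x t" for w x t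
  define N where "N w x t = A * \<bar>w x t\<bar> powr p + B * \<bar>U w x t\<bar> powr q" for w x t
  define \<phi> where "\<phi> x t = (\<alpha> (x + t) + \<beta> (x - t)) / 2" for x t
  have U_bd: "\<bar>U w x t\<bar> \<le> \<nu>" if w: "w \<in> X" and t: "t \<in> {0..T}" for w x t
  proof -
    \<comment> \<open>The vertical line over \<open>x\<close> lies within distance \<open>R\<close>
      of the cone exactly while \<open>s\<close> is within \<open>R\<close> of
      \<open>\<bar>x\<bar>\<close>; earlier \<open>w\<close> vanishes, later it has decayed.\<close>
    have "\<bar>ray 0 w x t\<bar> \<le> t * (\<mu> / S) + ((\<bar>x\<bar> + R) - (\<bar>x\<bar> - R)) * \<mu>"
    proof (rule abs_ray_le_bump[OF XD(1)[OF w]])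
      fix s assume "s \<in> {0..t}"
      then have s: "s \<in> {0..T}" using t by auto
      show "\<bar>w (x + 0 * (t - s)) s\<bar> \<le> \<mu> / S + (if s \<in> {\<bar>x\<bar> - R..\<bar>x\<bar> + R} then \<mu> else 0)"
        using XD(2)[OF w s, of x] XD(3)[OF w s, of x] XD(4)[OF w s, of x] \<mu>S by auto
    qed (use t \<mu>0 R in auto)
    also have "t * (\<mu> / S) \<le> S * (\<mu> / S)" using \<mu>S t S by (intro mult_right_mono) auto
    also have "S * (\<mu> / S) = \<mu>" using S by simp
    finally show ?thesis using bdd(3)[of x] unfolding U_def \<nu>[symmetric] by (simp add: algebra_simps)
  qed
  have U_0: "U w x t = 0" if w: "w \<in> X" and t: "t \<in> {0..T}" and x: "\<bar>x\<bar> > t + R" for w x t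
  proof -
    have "\<bar>ray 0 w x t\<bar> \<le> t * 0"
      by (rule abs_ray_le_const[OF XD(1)[OF w]]) (use XD(3)[OF w] t x in auto)
    then show ?thesis using zero(3)[of x] t x by (simp add: U_def)
  qed
  have cU: "continuous_on (strip T) (\<lambda>(x, t). U w x t)" if "w \<in> X" for w
    using continuous_on_ray[OF XD(1)[OF that], of 0] unfolding U_def split_beta
    by (intro continuous_intros continuous_on_compose2[OF cont(3)]) auto
  have cN: "continuous_on (strip T) (\<lambda>(x, t). N w x t)" if w: "w \<in> X" for w
  proof -
    have "continuous_on (strip T) (\<lambda>z. A * \<bar>w (fst z) (snd z)\<bar> powr p)"
      "continuous_on (strip T) (\<lambda>z. B * \<bar>U w (fst z) (snd z)\<bar> powr q)"
      using XD(1)[OF w] cU[OF w] pq unfolding split_beta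
      by (auto intro!: continuous_on_mult continuous_on_const continuous_on_compose2[OF continuous_on_abs_powr])
    then show ?thesis unfolding N_def split_beta by (rule continuous_on_add)
  qed
  have N0: "N w x t = 0" if "w \<in> X" "t \<in> {0..T}" "\<bar>x\<bar> > t + R" for w x t
    using XD(3)[OF that] U_0[OF that] by (simp add: N_def)
  have Nb: "\<bar>N w x t\<bar> \<le> A * r powr p + b0" if "w \<in> X" "t \<in> {0..T}" "\<bar>w x t\<bar> \<le> r" for w x t r
    using that pq AB U_bd[OF that(1,2), of x] unfolding N_def b0_def
    by (auto simp: abs_of_nonneg intro!: add_mono mult_left_mono powr_mono2)
  obtain L1 L2 where L12: "\<And>z. z \<in> {-\<nu>..\<nu>} \<Longrightarrow> \<bar>A * (p * sgn z * \<bar>z\<bar> powr (p - 1))\<bar> \<le> L1"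
     "\<And>z. z \<in> {-\<nu>..\<nu>} \<Longrightarrow> \<bar>B * (q * sgn z * \<bar>z\<bar> powr (q - 1))\<bar> \<le> L2"
  proof -
    have "continuous_on UNIV (\<lambda>z. C * (r * sgn z * \<bar>z\<bar> powr (r - 1)))" if "r > 1" for C r :: real
      using continuous_on_mult_left[OF continuous_on_sgn_abs_powr[of "r - 1"], of "C * r"] that by (simp add: ac_simps)
    note c = this
    show thesis
      by (rule continuous_bounded_Icc[OF c[OF pq(1)], of "- \<nu>" \<nu> A],
          rule continuous_bounded_Icc[OF c[OF pq(2)], of "- \<nu>" \<nu> B], rule that)
  qed
  \<comment> \<open>No smallness of \<open>L\<close> is claimed; the weight in the fixed point
    argument absorbs any value.\<close>
  define L where "L = max L1 L2"
  have L: "\<bar>A * (p * sgn z * \<bar>z\<bar> powr (p - 1))\<bar> \<le> L" "\<bar>B * (q * sgn z * \<bar>z\<bar> powr (q - 1))\<bar> \<le> L"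
    if "z \<in> {-\<nu>..\<nu>}" for z
    using L12[OF that] by (auto simp: L_def)
  have L0: "L \<ge> 0" using L(1)[of 0] \<mu>0 \<nu>0 by auto
  have "\<exists>w\<in>X. \<forall>x. \<forall>t\<in>{0..T}. w x t = \<phi> x t + wave (N w) x t"
  proof (rule wave_fixed_point[OF L0])
    show "(\<lambda>x t. 0) \<in> X" using \<mu>S \<mu>0 by (auto simp: X_def split_beta)
  next
    fix w assume w: "w \<in> X"
    show "continuous_on (strip T) (\<lambda>(x, t). w x t)" "continuous_on (strip T) (\<lambda>(x, t). N w x t)"
      by (rule XD[OF w] cN[OF w])+
    show "\<exists>M. \<forall>x. \<forall>t\<in>{0..T}. \<bar>w x t\<bar> \<le> M" using XD(2)[OF w] by blast
    have "continuous_on (strip T) (\<lambda>(x, t). \<phi> x t + wave (N w) x t)"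
      using continuous_on_wave[OF cN[OF w]] unfolding \<phi>_def split_beta
      by (intro continuous_intros continuous_on_compose2[OF cont(1)] continuous_on_compose2[OF cont(2)]) auto
    moreover have "\<phi> x t + wave (N w) x t = 0" if t: "t \<in> {0..T}" and x: "\<bar>x\<bar> > t + R" for x t
    proof -
      \<comment> \<open>Finite speed of propagation: a backward characteristic starting outside the
        region \<open>\<bar>x\<bar> \<le> t + R\<close> never enters it.\<close>
      have "\<bar>ray \<sigma> (N w) x t\<bar> \<le> t * 0" if \<sigma>: "\<sigma> \<in> {1, - 1}" for \<sigma>
      proof (rule abs_ray_le_const[OF cN[OF w]])
        fix s assume s: "s \<in> {0..t}"
        have "\<bar>x + \<sigma> * (t - s)\<bar> > s + R" using s x \<sigma> by auto
        then show "\<bar>N w (x + \<sigma> * (t - s)) s\<bar> \<le> 0" using N0[OF w, of s] s t by auto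
      qed (use t in auto)
      from this[of 1] this[of "-1"] have "wave (N w) x t = 0" by (simp add: wave_def)
      moreover have "\<bar>x + t\<bar> > R" "\<bar>x - t\<bar> > R" using x t by auto
      ultimately show ?thesis using zero by (simp add: \<phi>_def)
    qed
    moreover have "\<bar>\<phi> x t + wave (N w) x t\<bar> \<le> \<mu>" if t: "t \<in> {0..T}" for x t
    proof -
      have "\<bar>wave (N w) x t\<bar> \<le> T * (a0 + b0)"
        by (rule abs_wave_le_const[OF cN[OF w] t]) (use Nb[OF w _ XD(2)[OF w]] in \<open>auto simp: a0_def\<close>)
      also have "\<dots> \<le> S * (a0 * (R + 1)) + S * b0"
      proof -
        have "a0 \<le> a0 * (R + 1)" using ab0 R by (simp add: mult_le_cancel_left1)
        then have "T * a0 \<le> S * (a0 * (R + 1))" "T * b0 \<le> S * b0"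
          using S T ab0 by (auto intro!: mult_mono)
        then show ?thesis by (simp add: algebra_simps)
      qed
      \<comment> \<open>Each of the two nonlinear terms takes half of the available
        \<open>\<epsilon>\<close>.\<close>
      also have "\<dots> \<le> S * (\<epsilon> / (2 * S)) + \<epsilon> / 2"
      proof (rule add_mono)
        have "\<epsilon> / (2 * S) \<le> \<epsilon> / 2" using S \<epsilon> by (simp add: divide_simps)
        then show "S * b0 \<le> \<epsilon> / 2" using small'(2) by (simp add: mult.commute)
      qed (use S small' in \<open>intro mult_left_mono, auto\<close>)
      also have "\<dots> = \<epsilon>" using S by simp
      finally have "\<bar>wave (N w) x t\<bar> \<le> \<epsilon>" .
      moreover have "\<bar>\<phi> x t\<bar> \<le> m * \<epsilon>"
        using bdd(1)[of "x + t"] bdd(2)[of "x - t"] by (auto simp: \<phi>_def abs_le_iff)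
      ultimately show ?thesis by (simp add: \<mu>_def algebra_simps)
    qed
    moreover have "\<bar>\<phi> x t + wave (N w) x t\<bar> \<le> \<mu> / S" if t: "t \<in> {0..T}" and x: "\<bar>x\<bar> < t - R" for x t
    proof -
      have r: "\<bar>ray \<sigma> (N w) x t\<bar> \<le> \<mu> / S" if \<sigma>: "\<sigma> \<in> {1, - 1}" for \<sigma>
      proof -
        \<comment> \<open>Along the characteristic \<open>\<sigma> * y + s\<close> stays equal to
          \<open>\<sigma> * x + t\<close>, which exceeds \<open>R\<close> since
          \<open>\<bar>x\<bar> < t - R\<close>. So only the branch of the cone where
          \<open>\<sigma> * y\<close> is near \<open>s\<close> is met, and
          \<open>\<bar>\<sigma> * y - s\<bar> \<le> R\<close> describes a time window of length
          \<open>R\<close>.\<close>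
        have "\<bar>ray \<sigma> (N w) x t\<bar> \<le> t * (A * (\<mu> / S) powr p + b0)
            + ((t + \<sigma> * x + R) / 2 - (t + \<sigma> * x - R) / 2) * a0"
        proof (rule abs_ray_le_bump[OF cN[OF w]])
          fix s assume "s \<in> {0..t}"
          then have s: "s \<in> {0..T}" "s \<le> t" using t by auto
          let ?y = "x + \<sigma> * (t - s)"
          consider "s < (t + \<sigma> * x - R) / 2" | "s > (t + \<sigma> * x + R) / 2"
            | "s \<in> {(t + \<sigma> * x - R) / 2..(t + \<sigma> * x + R) / 2}" by fastforce
          then show "\<bar>N w ?y s\<bar> \<le> A * (\<mu> / S) powr p + b0
            + (if s \<in> {(t + \<sigma> * x - R) / 2..(t + \<sigma> * x + R) / 2} then a0 else 0)"
          proof cases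
            case 1
            then have "\<bar>?y\<bar> > s + R" using \<sigma> s x by auto
            from N0[OF w s(1) this] show ?thesis using ab0 AB by auto
          next
            case 2
            then have "\<bar>?y\<bar> < s - R" using \<sigma> s x by auto
            from Nb[OF w s(1) XD(4)[OF w s(1) this]] ab0 show ?thesis by auto
          next
            case 3
            have "0 \<le> A * (\<mu> / S) powr p" using AB by simp
            with 3 Nb[OF w s(1) XD(2)[OF w s(1)], of ?y] show ?thesis by (simp add: a0_def)
          qed
        qed (use t ab0 R in \<open>auto simp: divide_simps\<close>)
        also have "\<dots> = t * (A * (\<mu> / S) powr p) + t * b0 + R * a0" by (simp add: field_simps)
        also have "\<dots> \<le> a0 + S * b0 + R * a0"
        proof -
          \<comment> \<open>Here \<open>p > 1\<close> enters the decay: the factor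
            \<open>S powr p\<close> gained from the decayed \<open>w\<close> outweighs the
            integration time, which is at most \<open>S\<close>.\<close>
          have "S powr 1 \<le> S powr p" using S pq by (intro powr_mono) auto
          then have "S \<le> S powr p" using S by simp
          then have "A * (\<mu> / S) powr p \<le> a0 / S"
            using S \<mu>0 ab0 AB unfolding a0_def by (auto simp: powr_divide intro!: divide_left_mono mult_nonneg_nonneg)
          then have "t * (A * (\<mu> / S) powr p) \<le> S * (a0 / S)" using t S AB by (intro mult_mono) auto
          moreover have "t * b0 \<le> S * b0" using t S ab0 by (intro mult_right_mono) auto
          ultimately show ?thesis using S by simp
        qed
        also have "\<dots> = a0 * (R + 1) + b0 * S" by (simp add: algebra_simps)
        also have "\<dots> \<le> \<epsilon> / (2 * S) + \<epsilon> / (2 * S)" using small' by (rule add_mono)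
        also have "\<dots> = \<epsilon> / S" by simp
        also have "\<dots> \<le> \<mu> / S" using \<mu>0 S by (intro divide_right_mono) auto
        finally show ?thesis .
      qed
      \<comment> \<open>Huygens' principle for \<open>w\<close>: the free part has already passed,
        so nothing has to be compared with \<open>m * \<epsilon>\<close>.\<close>
      have "\<bar>x + t\<bar> > R" "\<bar>x - t\<bar> > R" using x t by auto
      then have "\<phi> x t = 0" using zero by (simp add: \<phi>_def)
      then show ?thesis using abs_wave_le[OF r r] by simp
    qed
    ultimately show "(\<lambda>x t. \<phi> x t + wave (N w) x t) \<in> X" by (simp add: X_def)
  next
    fix w w' x t assume w: "w \<in> X" "w' \<in> X" and t: "t \<in> {0..T}"
    have mem: "z x t \<in> {-\<nu>..\<nu>}" "U z x t \<in> {-\<nu>..\<nu>}" if "z \<in> X" for z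
      using XD(2)[OF that t, of x] U_bd[OF that t, of x] \<nu>0 by auto
    have "\<bar>A * \<bar>w x t\<bar> powr p - A * \<bar>w' x t\<bar> powr p\<bar> \<le> L * \<bar>w x t - w' x t\<bar>"
      by (rule lipschitz_from_derivative[where S = "{-\<nu>..\<nu>}", OF _ DERIV_cmult[OF has_real_derivative_abs_powr[OF pq(1)]] L(1)])
         (use mem w in auto)
    moreover have "\<bar>B * \<bar>U w x t\<bar> powr q - B * \<bar>U w' x t\<bar> powr q\<bar> \<le> L * \<bar>U w x t - U w' x t\<bar>"
      by (rule lipschitz_from_derivative[where S = "{-\<nu>..\<nu>}", OF _ DERIV_cmult[OF has_real_derivative_abs_powr[OF pq(2)]] L(2)])
         (use mem w in auto)
    ultimately show "\<bar>N w x t - N w' x t\<bar> \<le> L * (\<bar>w x t - w' x t\<bar> + \<bar>ray 0 w x t - ray 0 w' x t\<bar>)"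
      unfolding N_def U_def by (simp add: algebra_simps) linarith
  next
    fix ws w assume ws: "\<And>n. ws n \<in> X"
      and ul: "uniform_limit (strip T) (\<lambda>n (x, t). ws n x t) (\<lambda>(x, t). w x t) sequentially"
    have "continuous_on (strip T) (\<lambda>(x, t). w x t)"
      by (rule uniform_limit_theorem[OF _ ul]) (use XD(1)[OF ws] in auto)
    moreover have lim: "(\<lambda>n. ws n x t) \<longlonglongrightarrow> w x t" if "t \<in> {0..T}" for x t
      using tendsto_uniform_limitI[OF ul, of "(x, t)"] that by (simp add: strip_def)
    have bound: "\<bar>w x t\<bar> \<le> c" if "t \<in> {0..T}" "\<And>n. \<bar>ws n x t\<bar> \<le> c" for x t c
      by (rule LIMSEQ_le_const2[OF tendsto_rabs[OF lim[OF that(1)]]]) (use that in auto)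
    have "w x t = 0" if "t \<in> {0..T}" "\<bar>x\<bar> > t + R" for x t
      using bound[OF that(1), of x 0] XD(3)[OF ws that] by simp
    moreover have "\<bar>w x t\<bar> \<le> \<mu>" if "t \<in> {0..T}" for x t
      by (rule bound[OF that XD(2)[OF ws that]])
    moreover have "\<bar>w x t\<bar> \<le> \<mu> / S" if "t \<in> {0..T}" "\<bar>x\<bar> < t - R" for x t
      by (rule bound[OF that(1) XD(4)[OF ws that]])
    ultimately show "w \<in> X" by (simp add: X_def)
  qed
  then obtain w where w: "w \<in> X" "\<And>x t. t \<in> {0..T} \<Longrightarrow> w x t = \<phi> x t + wave (N w) x t" by blast
  show thesis
  proof (rule that[OF XD(1)[OF w(1)]])
    show "\<bar>w x t\<bar> \<le> (m + 1) * \<epsilon>" if "t \<in> {0..T}" for x t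
      using XD(2)[OF w(1) that] by (simp add: \<mu>_def)
  qed (use w(2) in \<open>simp add: N_def[abs_def] U_def[abs_def] \<phi>_def\<close>)
qed

text \<open>In either case of the lifespan, \<open>T\<close> is limited by the smaller of the
  exponents \<open>p - 1\<close> and \<open>(q - 1) / 2\<close>. As
  \<open>\<epsilon> \<le> 1\<close>, this controls the product with the larger one as well.\<close>

lemma powr_mult_le_of_le_powr_minus:
  fixes \<epsilon> r s c T :: real
  assumes "0 < \<epsilon>" "\<epsilon> \<le> 1" "r \<le> s" "c \<ge> 0" "T \<le> c * \<epsilon> powr (- r)"
  shows "\<epsilon> powr s * T \<le> c"
proof -
  have "\<epsilon> powr s * T \<le> \<epsilon> powr s * (c * \<epsilon> powr (- r))"
    using assms(5) by (rule mult_left_mono) simp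
  also have "\<dots> = c * \<epsilon> powr (s - r)"
    by (simp add: powr_diff powr_minus divide_simps)
  also have "\<dots> \<le> c * 1"
    using assms by (intro mult_left_mono powr_le1) auto
  finally show ?thesis by simp
qed

theorem theorem2p1:
  fixes p q A B R :: real and f g :: "real \<Rightarrow> real"
  assumes "p > 1" and "q > 1" and "A > 0" and "B > 0" and "R \<ge> 1"
    and "f \<in> C0_k 2" and "g \<in> C0_k 1"
    and "supp f \<subseteq> {x. \<bar>x\<bar> \<le> R}" and "supp g \<subseteq> {x. \<bar>x\<bar> \<le> R}"
    and "(LBINT x. g x) \<noteq> 0"
  shows "\<exists>\<epsilon>1>0. \<exists>c>0. \<forall>\<epsilon>. 0 < \<epsilon> \<and> \<epsilon> \<le> \<epsilon>1 \<longrightarrow>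
           (\<forall>T>0. (p \<le> (q + 1) / 2 \<longrightarrow> T \<le> c * \<epsilon> powr (- (p - 1))) \<and>
                  ((q + 1) / 2 \<le> p \<longrightarrow> T \<le> c * \<epsilon> powr (- ((q - 1) / 2)))
              \<longrightarrow> (\<exists>u. classical_solution p q A B (\<lambda>x. \<epsilon> * f x) (\<lambda>x. \<epsilon> * g x) T u))"
proof -
  define f' f'' g' where "f' = deriv f" and "f'' = deriv f'" and "g' = deriv g"
  have D: "(f has_real_derivative f' x) (at x)" "(f' has_real_derivative f'' x) (at x)"
    "(g has_real_derivative g' x) (at x)" for x
    using assms(6,7) unfolding f''_def f'_def g'_def
    by (auto simp: C0_k_def numeral_2_eq_2 DERIV_deriv_iff_real_differentiable)
  have c2: "continuous_on UNIV f''" "continuous_on UNIV g'"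
    using assms(6,7) by (auto simp: C0_k_def numeral_2_eq_2 f''_def f'_def g'_def)
  have c1: "continuous_on UNIV f" "continuous_on UNIV f'" "continuous_on UNIV g"
    by (rule DERIV_continuous_on[OF D(1)] DERIV_continuous_on[OF D(2)] DERIV_continuous_on[OF D(3)])+
  have z: "f x = 0" "g x = 0" if "\<bar>x\<bar> > R" for x
    using supp_zero_outside assms(8,9) that by blast+
  have z': "f' x = 0" "g' x = 0" if "\<bar>x\<bar> > R" for x
    unfolding f'_def g'_def using deriv_zero_outside[OF _ that] z by blast+
  have z'': "f'' x = 0" if "\<bar>x\<bar> > R" for x
    unfolding f''_def using deriv_zero_outside[OF _ that] z' by blast
  obtain m1 m2 m3 m4 m5 where mi: "\<And>x. \<bar>f x\<bar> \<le> m1" "\<And>x. \<bar>f' x\<bar> \<le> m2" "\<And>x. \<bar>f'' x\<bar> \<le> m3" "\<And>x. \<bar>g x\<bar> \<le> m4" "\<And>x. \<bar>g' x\<bar> \<le> m5"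
    using bounded_compact_support[OF c1(1) z(1)] bounded_compact_support[OF c1(2) z'(1)]
      bounded_compact_support[OF c2(1) z''] bounded_compact_support[OF c1(3) z(2)]
      bounded_compact_support[OF c2(2) z'(2)] by metis
  \<comment> \<open>The sum, rather than the maximum, also bounds the combinations of
    \<open>g\<close> and \<open>f'\<close> carried by the two characteristics.\<close>
  define m where "m = m1 + m2 + m3 + m4 + m5"
  have pos: "0 \<le> m1" "0 \<le> m2" "0 \<le> m3" "0 \<le> m4" "0 \<le> m5"
    using mi(1)[of 0] mi(2)[of 0] mi(3)[of 0] mi(4)[of 0] mi(5)[of 0] by linarith+
  have m: "\<bar>f x\<bar> \<le> m" "\<bar>f' x\<bar> \<le> m" "\<bar>f'' x\<bar> \<le> m" "\<bar>g' x\<bar> \<le> m"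
    "\<bar>g x + f' x\<bar> \<le> m" "\<bar>g x - f' x\<bar> \<le> m" for x
    using mi(1)[of x] mi(2)[of x] mi(3)[of x] mi(4)[of x] mi(5)[of x] pos unfolding m_def by linarith+
  have m0: "m \<ge> 0" using pos by (simp add: m_def)
  define n where "n = m + (2 * R + 1) * (m + 1)"
  have n0: "n \<ge> 0" using m0 assms(5) by (simp add: n_def)
  define C1 where "C1 = A * (m + 1) powr p * (R + 1)"
  define C2 where "C2 = B * n powr q"
  \<comment> \<open>The smallness conditions will be reached with \<open>2 * c\<close> for the
    \<open>p\<close>-term and \<open>4 * c\<close> for the \<open>q\<close>-term, so
    \<open>c\<close> has to beat \<open>C1\<close> and \<open>C2\<close>; the summand 1 also ensures
    \<open>c \<le> 1\<close>.\<close>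
  define c where "c = 1 / (8 * (1 + C1 + C2))"
  have C: "C1 \<ge> 0" "C2 \<ge> 0" using assms(3-5) by (auto simp: C1_def C2_def)
  have c: "c > 0" "c \<le> 1" "C1 * (2 * c) \<le> 1 / 2" "C2 * (4 * c) \<le> 1 / 2"
    using C by (auto simp: c_def divide_simps)
  \<comment> \<open>Makes both powers of \<open>\<epsilon>\<close> at most \<open>c\<close>, which
    pays for the summand 1 in \<open>1 + T\<close>; the hypothesis on \<open>T\<close> pays for the
    rest.\<close>
  define \<epsilon>1 where "\<epsilon>1 = min 1 (min (c powr (1 / (p - 1))) (c powr (1 / ((q - 1) / 2))))"
  have "\<exists>u. classical_solution p q A B (\<lambda>x. \<epsilon> * f x) (\<lambda>x. \<epsilon> * g x) T u"
    if \<epsilon>: "0 < \<epsilon>" "\<epsilon> \<le> \<epsilon>1" and T: "T > 0"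
      and T1: "p \<le> (q + 1) / 2 \<Longrightarrow> T \<le> c * \<epsilon> powr (- (p - 1))"
      and T2: "(q + 1) / 2 \<le> p \<Longrightarrow> T \<le> c * \<epsilon> powr (- ((q - 1) / 2))" for \<epsilon> T
  proof -
    have \<epsilon>': "\<epsilon> \<le> 1" "\<epsilon> \<le> c powr (1 / (p - 1))" "\<epsilon> \<le> c powr (1 / ((q - 1) / 2))"
      using \<epsilon> by (auto simp: \<epsilon>1_def)
    have root: "\<epsilon> powr r \<le> c" if "\<epsilon> \<le> c powr (1 / r)" "r > 0" for r
    proof -
      have "\<epsilon> powr r \<le> (c powr (1 / r)) powr r" using that \<epsilon> by (intro powr_mono2) auto
      also have "\<dots> = c" using that c by (simp add: powr_powr)
      finally show ?thesis .
    qed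
    have e: "\<epsilon> powr (p - 1) \<le> c" "\<epsilon> powr ((q - 1) / 2) \<le> c"
      using root[OF \<epsilon>'(2)] root[OF \<epsilon>'(3)] assms(1,2) by auto
    have eT: "\<epsilon> powr (p - 1) * T \<le> c" "\<epsilon> powr ((q - 1) / 2) * T \<le> c"
    proof -
      consider "p \<le> (q + 1) / 2" | "(q + 1) / 2 \<le> p" by linarith
      then have "\<epsilon> powr (p - 1) * T \<le> c \<and> \<epsilon> powr ((q - 1) / 2) * T \<le> c"
      proof cases
        case 1
        then show ?thesis
          using powr_mult_le_of_le_powr_minus[OF \<epsilon>(1) \<epsilon>'(1) _ less_imp_le[OF c(1)] T1[OF 1]]
          by (simp add: field_simps)
      next
        case 2
        then show ?thesis
          using powr_mult_le_of_le_powr_minus[OF \<epsilon>(1) \<epsilon>'(1) _ less_imp_le[OF c(1)] T2[OF 2]]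
          by (simp add: field_simps)
      qed
      then show "\<epsilon> powr (p - 1) * T \<le> c" "\<epsilon> powr ((q - 1) / 2) * T \<le> c" by auto
    qed
    have s1: "\<epsilon> powr (p - 1) * (1 + T) \<le> 2 * c" using e eT by (simp add: algebra_simps)
    have s2: "\<epsilon> powr (q - 1) * (1 + T)\<^sup>2 \<le> 4 * c"
    proof -
      \<comment> \<open>The quadratic condition is the square of a linear one with exponent
        \<open>(q - 1) / 2\<close>; the square of \<open>2 * c\<close> is at most
        \<open>4 * c\<close> because \<open>c \<le> 1\<close>.\<close>
      have h: "\<epsilon> powr ((q - 1) / 2) * (1 + T) \<le> 2 * c" using e eT by (simp add: algebra_simps)
      have "\<epsilon> powr (q - 1) = \<epsilon> powr ((q - 1) / 2) * \<epsilon> powr ((q - 1) / 2)"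
        by (simp add: powr_add[symmetric])
      then have "\<epsilon> powr (q - 1) * (1 + T)\<^sup>2 = (\<epsilon> powr ((q - 1) / 2) * (1 + T))\<^sup>2"
        by (simp add: power2_eq_square)
      also have "\<dots> \<le> (2 * c)\<^sup>2" using h T by (intro power_mono) auto
      also have "\<dots> \<le> 4 * c" using c by (simp add: power2_eq_square mult_left_le)
      finally show ?thesis .
    qed
    have split: "(k * \<epsilon>) powr r = k powr r * \<epsilon> powr (r - 1) * \<epsilon>" if "k \<ge> 0" for k r
      using that \<epsilon> by (simp add: powr_mult powr_diff)
    have small1: "A * ((m + 1) * \<epsilon>) powr p * (R + 1) * (1 + T) \<le> \<epsilon> / 2"
    proof -
      have "A * ((m + 1) * \<epsilon>) powr p * (R + 1) * (1 + T) = \<epsilon> * (C1 * (\<epsilon> powr (p - 1) * (1 + T)))"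
        using m0 by (subst split) (simp_all add: C1_def)
      also have "\<dots> \<le> \<epsilon> * (C1 * (2 * c))" using s1 C \<epsilon> by (intro mult_left_mono) auto
      also have "\<dots> \<le> \<epsilon> * (1 / 2)" using c \<epsilon> by (intro mult_left_mono) auto
      finally show ?thesis by simp
    qed
    have small2: "B * (n * \<epsilon>) powr q * (1 + T)\<^sup>2 \<le> \<epsilon> / 2"
    proof -
      have "B * (n * \<epsilon>) powr q * (1 + T)\<^sup>2 = \<epsilon> * (C2 * (\<epsilon> powr (q - 1) * (1 + T)\<^sup>2))"
        using n0 by (subst split) (simp_all add: C2_def)
      also have "\<dots> \<le> \<epsilon> * (C2 * (4 * c))" using s2 C \<epsilon> by (intro mult_left_mono) auto
      also have "\<dots> \<le> \<epsilon> * (1 / 2)" using c \<epsilon> by (intro mult_left_mono) auto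
      finally show ?thesis by simp
    qed
    have sc: "\<bar>\<epsilon> * y\<bar> \<le> m * \<epsilon>" if "\<bar>y\<bar> \<le> m" for y
      using that \<epsilon>(1) by (simp add: abs_mult mult.commute)
    define \<alpha> \<beta> where "\<alpha> x = \<epsilon> * (g x + f' x)" and "\<beta> x = \<epsilon> * (g x - f' x)" for x
    obtain w where w: "continuous_on (strip T) (\<lambda>(x, t). w x t)"
      "\<And>x t. t \<in> {0..T} \<Longrightarrow> \<bar>w x t\<bar> \<le> (m + 1) * \<epsilon>"
      "\<And>x t. t \<in> {0..T} \<Longrightarrow> w x t = (\<alpha> (x + t) + \<beta> (x - t)) / 2
          + wave (\<lambda>x t. A * \<bar>w x t\<bar> powr p + B * \<bar>\<epsilon> * f x + ray 0 w x t\<bar> powr q) x t"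
    proof (rule wave_solution_exists[of p q A B R T \<epsilon> \<alpha> \<beta> "\<lambda>x. \<epsilon> * f x" m])
      show "continuous_on UNIV \<alpha>" "continuous_on UNIV \<beta>" "continuous_on UNIV (\<lambda>x. \<epsilon> * f x)"
        unfolding \<alpha>_def \<beta>_def using c1 by (auto intro!: continuous_intros)
      show "\<bar>\<alpha> x\<bar> \<le> m * \<epsilon>" "\<bar>\<beta> x\<bar> \<le> m * \<epsilon>" "\<bar>\<epsilon> * f x\<bar> \<le> m * \<epsilon>" for x
        unfolding \<alpha>_def \<beta>_def by (intro sc m)+
    qed (use assms(1-5) T \<epsilon> z z' small1 small2[unfolded n_def] in \<open>auto simp: \<alpha>_def \<beta>_def\<close>)
    define u where "u = (\<lambda>x t. \<epsilon> * f x + ray 0 w x t)"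
    have uc: "uniformly_continuous_on UNIV (\<lambda>x. \<epsilon> * f' x)" "uniformly_continuous_on UNIV (\<lambda>x. \<epsilon> * f'' x)"
      "uniformly_continuous_on UNIV (\<lambda>x. \<epsilon> * g' x)"
      using z' z'' c1 c2 by (auto intro!: uniformly_continuous_compact_support[of _ R] continuous_intros)
    have cp: "continuous_on UNIV (\<lambda>z. C * (r * sgn z * \<bar>z\<bar> powr (r - 1)))" if "r > 1" for C r :: real
      using continuous_on_mult_left[OF continuous_on_sgn_abs_powr[of "r - 1"], of "C * r"] that by (simp add: ac_simps)
    have eq: "w x t = ((\<epsilon> * g (x + t) + \<epsilon> * f' (x + t)) + (\<epsilon> * g (x - t) - \<epsilon> * f' (x - t))) / 2
       + wave (\<lambda>x t. A * \<bar>w x t\<bar> powr p + B * \<bar>\<epsilon> * f x + ray 0 w x t\<bar> powr q) x t" if "t \<in> {0..T}" for x t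
      using w(3)[OF that, of x] by (simp add: \<alpha>_def \<beta>_def algebra_simps)
    have wb: "\<bar>w x t\<bar> \<le> (m + 1) * \<epsilon>" "\<bar>\<epsilon> * f y\<bar> \<le> (m + 1) * \<epsilon>" if "t \<in> {0..T}" for x t y
      using w(2)[OF that] sc[OF m(1), of y] \<epsilon>(1) by (auto simp: algebra_simps intro: order_trans)
    note wb' = wb(2)[of 0]
    note sol = wave_solution_classical[OF T w(1) wb(1)
        DERIV_cmult[OF D(1)] DERIV_cmult[OF D(2)] uc(1,2) DERIV_cmult[OF D(3)] uc(3)
        wb' sc[OF m(2)] sc[OF m(3)] sc[OF m(4)]
        DERIV_cmult[OF has_real_derivative_abs_powr[OF assms(1)]] cp[OF assms(1)]
        DERIV_cmult[OF has_real_derivative_abs_powr[OF assms(2)]] cp[OF assms(2)] eq, folded u_def]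
    have u_apply: "u x t = \<epsilon> * f x + ray 0 w x t" for x t by (simp add: u_def)
    show ?thesis
    proof (intro exI[of _ u])
      show "classical_solution p q A B (\<lambda>x. \<epsilon> * f x) (\<lambda>x. \<epsilon> * g x) T u"
        unfolding classical_solution_def using sol T by (auto simp: u_apply)
    qed
  qed
  moreover have "\<epsilon>1 > 0" using c by (simp add: \<epsilon>1_def)
  ultimately show ?thesis using c(1) by blast
qed

end
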